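(* Let $\Omega\subset\mathbb{R}^2$ be a bounded domain such that the Dirichlet Laplacian in $\Omega$ has an eigenfunction $v$ (that is, $v\neq0$, $\Delta v+k^2v=0$ in $\Omega$ for some $k>0$, and $v=0$ on $\partial\Omega$) that can be extended to a function $\tilde v$ satisfying $\Delta\tilde v+k^2\tilde v=0$ in a neighbourhood of $\overline{\Omega}$. If $P\in\partial\Omega$ is a corner point of $\Omega$ with opening angle $\alpha$, then necessarily $\alpha\in(0,2\pi)\cap\mathbb{Q}\pi$.
   Context: The domain $\Omega$ is assumed to have Lipschitz boundary, with $\mathbb{R}^2\setminus\overline\Omega$ connected. A corner point $P\in\partial\Omega$ with opening angle $\alpha$ is understood in the usual sense: near $P$, $\partial\Omega$ consists of two regular arcs emanating from $P$ whose tangent half-lines at $P$ bound a sector of angle $\alpha$ on the side of $\Omega$. $\mathbb{Q}\pi=\{r\pi : r\in\mathbb{Q}\}$. *)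

theory Defs
  imports "HOL-Analysis.Analysis"
begin

definition dir_deriv ::
  "'a::euclidean_space \<Rightarrow> ('a \<Rightarrow> 'b::real_normed_vector) \<Rightarrow> 'a \<Rightarrow> 'b"
  where "dir_deriv b f x = frechet_derivative f (at x) b"

definition C1_on :: "'a::euclidean_space set \<Rightarrow> ('a \<Rightarrow> 'b::real_normed_vector) \<Rightarrow> bool"
  where "C1_on U f \<longleftrightarrow> (\<forall>x\<in>U. f differentiable (at x)) \<and>
    (\<forall>b\<in>Basis. continuous_on U (dir_deriv b f))"

definition C2_on :: "'a::euclidean_space set \<Rightarrow> ('a \<Rightarrow> 'b::real_normed_vector) \<Rightarrow> bool"
  where "C2_on U f \<longleftrightarrow> C1_on U f \<and> (\<forall>b\<in>Basis. C1_on U (dir_deriv b f))"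

definition laplacian :: "('a::euclidean_space \<Rightarrow> 'b::real_normed_vector) \<Rightarrow> 'a \<Rightarrow> 'b"
  where "laplacian f x = (\<Sum>b\<in>Basis. dir_deriv b (dir_deriv b f) x)"

(* Classical solutions; U is always taken open. *)
definition helmholtz_on ::
  "real \<Rightarrow> 'a::euclidean_space set \<Rightarrow> ('a \<Rightarrow> 'b::real_normed_vector) \<Rightarrow> bool"
  where "helmholtz_on k U f \<longleftrightarrow> C2_on U f \<and> (\<forall>x\<in>U. laplacian f x + k\<^sup>2 *\<^sub>R f x = 0)"

definition dirichlet_eigenfunction ::
  "real \<Rightarrow> 'a::euclidean_space set \<Rightarrow> ('a \<Rightarrow> 'b::real_normed_vector) \<Rightarrow> bool"
  where "dirichlet_eigenfunction k \<Omega> v \<longleftrightarrow>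
    helmholtz_on k \<Omega> v \<and> continuous_on (closure \<Omega>) v \<and>
    (\<forall>x\<in>frontier \<Omega>. v x = 0) \<and> (\<exists>x\<in>\<Omega>. v x \<noteq> 0)"

(* Near each boundary point, in a suitable orthonormal frame (e1, e2), the set is the
   strict epigraph of a Lipschitz function. *)
definition lipschitz_boundary :: "(real^2) set \<Rightarrow> bool"
  where "lipschitz_boundary \<Omega> \<longleftrightarrow>
    (\<forall>p\<in>frontier \<Omega>. \<exists>e1 e2 r L. \<exists>g :: real \<Rightarrow> real.
      norm e1 = 1 \<and> norm e2 = 1 \<and> e1 \<bullet> e2 = 0 \<and> r > 0 \<and> L-lipschitz_on UNIV g \<and>
      \<Omega> \<inter> ball p r = {x \<in> ball p r. g (x \<bullet> e1) < x \<bullet> e2})"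

definition unit_dir :: "real \<Rightarrow> real^2"
  where "unit_dir \<theta> = vector [cos \<theta>, sin \<theta>]"

(* A C^1 arc, regular up to its end points, that starts at p with tangent half-line
   in the direction unit_dir \<theta>. *)
definition regular_arc_from :: "real^2 \<Rightarrow> real \<Rightarrow> (real \<Rightarrow> real^2) \<Rightarrow> bool"
  where "regular_arc_from p \<theta> \<gamma> \<longleftrightarrow> arc \<gamma> \<and> pathstart \<gamma> = p \<and>
    (\<exists>\<gamma>'. continuous_on {0..1} \<gamma>' \<and>
       (\<forall>t\<in>{0..1}. (\<gamma> has_vector_derivative \<gamma>' t) (at t within {0..1}) \<and> \<gamma>' t \<noteq> 0) \<and>
       (\<exists>c>0. \<gamma>' 0 = c *\<^sub>R unit_dir \<theta>))"

(* The sector of angle \<alpha> runs counterclockwise from the direction \<theta> to \<theta> + \<alpha>. It lies on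
   the side of the domain: rays from p strictly inside the sector start in the domain,
   rays strictly inside the complementary sector start outside; nothing is asked of the
   two tangent rays. The range of \<alpha> includes the cusps \<alpha> = 0 and \<alpha> = 2 * pi, as well as
   \<alpha> = pi, so that no restriction on \<alpha> is built into the notion. *)
definition corner_point :: "(real^2) set \<Rightarrow> real^2 \<Rightarrow> real \<Rightarrow> bool"
  where "corner_point \<Omega> p \<alpha> \<longleftrightarrow>
    p \<in> frontier \<Omega> \<and> 0 \<le> \<alpha> \<and> \<alpha> \<le> 2 * pi \<and>
    (\<exists>\<theta> \<gamma>1 \<gamma>2 \<epsilon>.
      regular_arc_from p \<theta> \<gamma>1 \<and> regular_arc_from p (\<theta> + \<alpha>) \<gamma>2 \<and>
      path_image \<gamma>1 \<inter> path_image \<gamma>2 = {p} \<and> \<epsilon> > 0 \<and>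
      frontier \<Omega> \<inter> ball p \<epsilon> = (path_image \<gamma>1 \<union> path_image \<gamma>2) \<inter> ball p \<epsilon> \<and>
      (\<forall>\<phi>\<in>{\<theta><..<\<theta> + \<alpha>}. \<forall>\<^sub>F r in at_right 0. p + r *\<^sub>R unit_dir \<phi> \<in> \<Omega>) \<and>
      (\<forall>\<phi>\<in>{\<theta> + \<alpha><..<\<theta> + 2 * pi}. \<forall>\<^sub>F r in at_right 0. p + r *\<^sub>R unit_dir \<phi> \<notin> \<Omega>))"

end

theory Submission
  imports Defs
begin

text \<open>
  In a disc about a point of \<open>U\<close>, the angular Fourier coefficients \<open>c\<^sub>m(r)\<close> of a solution satisfy Bessel's equation.
  If the radius \<open>R\<close> is small compared with \<open>1/k\<close>, this gives \<open>|c\<^sub>m(r)| \<le> 2 M (r/R)^|m|\<close> and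
  \<open>c\<^sub>m(r) = C\<^sub>m r^|m| + O(r^(|m|+2))\<close>, where \<open>C\<^sub>m = 0\<close> only if \<open>c\<^sub>m\<close> vanishes identically.
  Hence a solution that vanishes near a point vanishes on a disc of uniform radius, which yields unique continuation
  in \<open>\<Omega>\<close>; and a nontrivial solution with a zero at \<open>P\<close> behaves like \<open>a \<zeta>\<^sup>N + b \<zeta>'\<^sup>N\<close> to leading order,
  with \<open>N > 0\<close>, \<open>\<zeta>\<close> the complex coordinate centred at \<open>P\<close> and \<open>\<zeta>'\<close> its conjugate.
  As the extension vanishes along both boundary arcs, the leading term vanishes in both tangent
  directions, and subtracting the two phases gives \<open>2 N \<alpha> \<in> 2\<pi>\<int>\<close>. The cusps \<open>\<alpha> = 0\<close> and \<open>\<alpha> = 2\<pi>\<close> are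
  excluded by the interior and exterior cones of the Lipschitz boundary.
\<close>

section \<open>The radial equation\<close>

text \<open>A solution is only known to be of class C^2, so neither a power series nor a Bessel
  function is at hand, and the expansion at \<open>P\<close> has to come out of integral estimates.
  Bessel's equation is therefore kept as a first-order system for a coefficient of \<open>f\<close>
  and a neighbouring coefficient of \<open>fx + \<sigma> * \<i> * fy\<close>. The equation of the
  latter can be integrated from the centre, where boundedness of the gradient discards the singular
  solution. Two kinds of constants have to be kept apart. The bound
  \<open>2 * M * (r / R) ^ n\<close> must be uniform in the order, because all modes are summed; the
  error constants of the asymptotics may depend on the order, because they are used for one mode at
  a time. The modes below the leading order \<open>N\<close> must vanish identically and not only to
  first order: a mode of order n < N with \<open>C = 0\<close> could otherwise leave a term of size
  r^(n+2), which may compete with r^N. As \<open>P\<close> lies on the boundary, nontriviality near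
  \<open>P\<close> has to be carried there from inside \<open>\<Omega>\<close>; this is the purpose
  of unique continuation.\<close>

lemma vector_derivative_bound:
  fixes h h' :: "real \<Rightarrow> 'a::real_normed_vector"
  assumes "a \<le> b" and "\<And>s. a \<le> s \<Longrightarrow> s \<le> b \<Longrightarrow> (h has_vector_derivative h' s) (at s)"
    and "\<And>s. a \<le> s \<Longrightarrow> s \<le> b \<Longrightarrow> norm (h' s) \<le> B"
  shows "norm (h b - h a) \<le> B * (b - a)"
proof -
  have "norm (h b - h a) \<le> B * norm (b - a)"
  proof (rule differentiable_bound[of "{a..b}" h "\<lambda>s x. x *\<^sub>R h' s"])
    fix s assume s: "s \<in> {a..b}"
    show "(h has_derivative (\<lambda>x. x *\<^sub>R h' s)) (at s within {a..b})"
      using assms(2)[of s] s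
      by (auto simp: has_vector_derivative_def intro: has_derivative_at_withinI)
    show "onorm (\<lambda>x. x *\<^sub>R h' s) \<le> B"
      using assms(3)[of s] s by (intro onorm_le) (simp add: mult.commute[of B] mult_left_mono)
  qed (use assms(1) in auto)
  then show ?thesis using assms(1) by simp
qed

lemma coeff_nonneg_of_norm_le:
  assumes "norm x \<le> A * s ^ j" "0 < (s::real)"
  shows "0 \<le> A"
proof (rule ccontr)
  assume "\<not> 0 \<le> A"
  then have "A * s ^ j < 0" using assms(2) by (intro mult_neg_pos) auto
  then show False using assms(1) norm_ge_zero[of x] by linarith
qed

text \<open>The equations for \<open>u\<close> and \<open>d\<close> below are the first-order form of the Bessel equation
  for the \<open>n\<close>-th angular Fourier coefficient of a solution of the Helmholtz equation.\<close>

lemma radial_step: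
  fixes u d :: "real \<Rightarrow> 'a::real_normed_vector"
  assumes d': "\<And>s. 0 < s \<Longrightarrow> s \<le> R \<Longrightarrow>
      ((\<lambda>s. s ^ (n+1) *\<^sub>R d s) has_vector_derivative - (k\<^sup>2 * s ^ (n+1)) *\<^sub>R u s) (at s)"
    and dM: "\<And>s. 0 < s \<Longrightarrow> s \<le> R \<Longrightarrow> norm (d s) \<le> M'"
    and uA: "\<And>s. 0 < s \<Longrightarrow> s \<le> R \<Longrightarrow> norm (u s) \<le> A * s ^ j"
    and s: "0 < s" "s \<le> R"
  shows "norm (d s) \<le> k\<^sup>2 * A * s ^ (j+1)"
proof -
  have A0: "A \<ge> 0"
    using coeff_nonneg_of_norm_le[OF uA[OF s] s(1)] .
  let ?h = "\<lambda>s. s ^ (n+1) *\<^sub>R d s"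
  have b: "norm (?h s - ?h \<epsilon>) \<le> k\<^sup>2 * A * s ^ (n+1+j) * (s - \<epsilon>)" if e: "0 < \<epsilon>" "\<epsilon> < s" for \<epsilon>
  proof (rule vector_derivative_bound)
    fix t assume t: "\<epsilon> \<le> t" "t \<le> s"
    show "(?h has_vector_derivative - (k\<^sup>2 * t ^ (n+1)) *\<^sub>R u t) (at t)"
      using d'[of t] t s e by simp
    have "norm (- (k\<^sup>2 * t ^ (n+1)) *\<^sub>R u t) \<le> (k\<^sup>2 * t ^ (n+1)) * (A * t ^ j)"
      using uA[of t] t s e by (auto simp: abs_mult intro!: mult_left_mono)
    also have "\<dots> = k\<^sup>2 * A * t ^ (n+1+j)" by (simp add: power_add)
    also have "\<dots> \<le> k\<^sup>2 * A * s ^ (n+1+j)"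
      using t e A0 by (intro mult_left_mono power_mono) auto
    finally show "norm (- (k\<^sup>2 * t ^ (n+1)) *\<^sub>R u t) \<le> k\<^sup>2 * A * s ^ (n+1+j)" .
  qed (use e in auto)
  have "((\<lambda>\<epsilon>. \<epsilon> ^ (n+1)) \<longlongrightarrow> 0 ^ (n+1)) (at_right (0::real))"
    by (intro tendsto_intros)
  then have lim: "((\<lambda>\<epsilon>. \<epsilon> ^ (n+1)) \<longlongrightarrow> 0) (at_right (0::real))" by simp
  \<comment> \<open>Boundedness of \<open>d\<close> is what excludes the singular solution of
    Bessel's equation: it makes the boundary term at the origin vanish, so that \<open>d\<close> is
    controlled by the integral of \<open>u\<close> alone.\<close>
  have h0: "(?h \<longlongrightarrow> 0) (at_right 0)"
  proof (rule Lim_null_comparison)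
    show "\<forall>\<^sub>F \<epsilon> in at_right 0. norm (?h \<epsilon>) \<le> \<epsilon> ^ (n+1) * M'"
      unfolding eventually_at_right_field
      by (rule exI[of _ R]) (use s dM in \<open>auto intro!: mult_left_mono\<close>)
    show "((\<lambda>\<epsilon>. \<epsilon> ^ (n+1) * M') \<longlongrightarrow> 0) (at_right 0)"
      using tendsto_mult_right[OF lim, of M'] by simp
  qed
  have lim_l: "((\<lambda>\<epsilon>. norm (?h s - ?h \<epsilon>)) \<longlongrightarrow> norm (?h s - 0)) (at_right 0)"
    by (intro tendsto_intros h0)
  have lim_r: "((\<lambda>\<epsilon>. k\<^sup>2 * A * s ^ (n+1+j) * (s - \<epsilon>)) \<longlongrightarrow> k\<^sup>2 * A * s ^ (n+1+j) * (s - 0)) (at_right 0)"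
    by (intro tendsto_intros)
  have ev: "\<forall>\<^sub>F \<epsilon> in at_right 0. norm (?h s - ?h \<epsilon>) \<le> k\<^sup>2 * A * s ^ (n+1+j) * (s - \<epsilon>)"
    unfolding eventually_at_right_field by (rule exI[of _ s]) (use b s in blast)
  have "norm (?h s - 0) \<le> k\<^sup>2 * A * s ^ (n+1+j) * (s - 0)"
    by (rule tendsto_le[OF trivial_limit_at_right_real lim_r lim_l ev])
  then have "s ^ (n+1) * norm (d s) \<le> s ^ (n+1) * (k\<^sup>2 * A * s ^ (j+1))"
    using s by (simp add: power_add mult_ac)
  then show ?thesis using s by (simp only: mult_le_cancel_left_pos zero_less_power)
qed

lemma radial_bound:
  fixes u d :: "real \<Rightarrow> 'a::real_normed_vector"
  assumes R: "0 < R" "k\<^sup>2 * R\<^sup>2 \<le> 1/2"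
    and u': "\<And>s. 0 < s \<Longrightarrow> s \<le> R \<Longrightarrow>
      ((\<lambda>s. inverse (s ^ n) *\<^sub>R u s) has_vector_derivative inverse (s ^ n) *\<^sub>R d s) (at s)"
    and d': "\<And>s. 0 < s \<Longrightarrow> s \<le> R \<Longrightarrow>
      ((\<lambda>s. s ^ (n+1) *\<^sub>R d s) has_vector_derivative - (k\<^sup>2 * s ^ (n+1)) *\<^sub>R u s) (at s)"
    and uM: "\<And>s. 0 < s \<Longrightarrow> s \<le> R \<Longrightarrow> norm (u s) \<le> M"
    and dM: "\<And>s. 0 < s \<Longrightarrow> s \<le> R \<Longrightarrow> norm (d s) \<le> M'"
    and r: "0 < r" "r \<le> R"
  shows "norm (u r) \<le> 2 * M * (r / R) ^ n"
proof -
  \<comment> \<open>Induction on the order \<open>j \<le> n\<close> of the bound \<open>2 * M * (r / R) ^ j\<close>, integrating the system inwards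
    from \<open>R\<close>; smallness of \<open>k * R\<close> keeps the constant equal to 2.\<close>
  have M0: "M \<ge> 0" using uM[OF r] norm_ge_zero order_trans by blast
  have "j \<le> n \<Longrightarrow> 0 < r \<Longrightarrow> r \<le> R \<Longrightarrow> norm (u r) \<le> 2 * M * (r / R) ^ j" for j r
  proof (induction j arbitrary: r)
    case 0
    then show ?case using uM[of r] M0 by simp
  next
    case (Suc j)
    define A where "A = 2 * M / R ^ j"
    have A0: "A \<ge> 0" using M0 R by (simp add: A_def)
    have uA: "norm (u s) \<le> A * s ^ j" if "0 < s" "s \<le> R" for s
      using Suc.IH[of s] Suc.prems that by (simp add: A_def power_divide)
    have dA: "norm (d s) \<le> k\<^sup>2 * A * s ^ (j+1)" if "0 < s" "s \<le> R" for s
      by (rule radial_step[OF d' dM uA that])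
    let ?B = "inverse (r ^ n) * (k\<^sup>2 * A * r ^ (j+1))"
    have "norm (inverse (R ^ n) *\<^sub>R u R - inverse (r ^ n) *\<^sub>R u r) \<le> ?B * (R - r)"
    proof (rule vector_derivative_bound)
      fix t assume t: "r \<le> t" "t \<le> R"
      then have t0: "0 < t" using Suc.prems by simp
      show "((\<lambda>s. inverse (s ^ n) *\<^sub>R u s) has_vector_derivative inverse (t ^ n) *\<^sub>R d t) (at t)"
        using u'[OF t0] t by simp
      \<comment> \<open>This is where \<open>Suc j \<le> n\<close> enters: the integrand is bounded
        by a constant times the inverse of \<open>t ^ (n - Suc j)\<close>, which decreases in
        \<open>t\<close> and is largest at \<open>r\<close>.\<close>
      have e: "x ^ n = x ^ (n - Suc j) * x ^ (j+1)" for x :: real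
        using Suc.prems(1) by (simp only: power_add[symmetric]) simp
      have "norm (inverse (t ^ n) *\<^sub>R d t) \<le> inverse (t ^ n) * (k\<^sup>2 * A * t ^ (j+1))"
        using dA[OF t0 t(2)] t0 by (simp add: mult_left_mono)
      also have "\<dots> = k\<^sup>2 * A * inverse (t ^ (n - Suc j))"
        using t0 by (simp add: e field_simps)
      also have "\<dots> \<le> k\<^sup>2 * A * inverse (r ^ (n - Suc j))"
        using t t0 Suc.prems A0 by (intro mult_left_mono le_imp_inverse_le power_mono) auto
      also have "\<dots> = ?B"
        using Suc.prems by (simp add: e field_simps)
      finally show "norm (inverse (t ^ n) *\<^sub>R d t) \<le> ?B" .
    qed (use Suc.prems in auto)
    also have "\<dots> \<le> ?B * R"
      using Suc.prems A0 by (intro mult_left_mono) auto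
    finally have "norm (inverse (r ^ n) *\<^sub>R u r) \<le> norm (inverse (R ^ n) *\<^sub>R u R) + ?B * R"
      using norm_triangle_sub[of "inverse (r ^ n) *\<^sub>R u r" "inverse (R ^ n) *\<^sub>R u R"]
      by (simp add: norm_minus_commute)
    also have "\<dots> \<le> inverse (R ^ n) * M + ?B * R"
      using uM[of R] R by (simp add: mult_left_mono)
    finally have "r ^ n * norm (inverse (r ^ n) *\<^sub>R u r) \<le> r ^ n * (inverse (R ^ n) * M + ?B * R)"
      using Suc.prems by (intro mult_left_mono) auto
    moreover have "r ^ n * norm (inverse (r ^ n) *\<^sub>R u r) = norm (u r)"
      using Suc.prems by simp
    moreover have "r ^ n * (inverse (R ^ n) * M + ?B * R) = M * (r / R) ^ n + k\<^sup>2 * A * r ^ (j+1) * R"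
      using Suc.prems by (simp add: power_divide field_simps)
    ultimately have "norm (u r) \<le> M * (r / R) ^ n + k\<^sup>2 * A * r ^ (j+1) * R"
      by (simp only:)
    also have "k\<^sup>2 * A * r ^ (j+1) * R = 2 * (k\<^sup>2 * R\<^sup>2) * (M * (r / R) ^ (j+1))"
      using R by (simp add: A_def power_divide field_simps power2_eq_square)
    \<comment> \<open>By \<open>k\<^sup>2 * R\<^sup>2 \<le> 1/2\<close> the integral contributes one
      \<open>M\<close>; the value at \<open>R\<close> contributes the other, which restores the
      factor 2 for the next order.\<close>
    also have "\<dots> \<le> 1 * (M * (r / R) ^ (j+1))"
      using R M0 Suc.prems by (intro mult_right_mono) auto
    also have "M * (r / R) ^ n \<le> M * (r / R) ^ (j+1)"
      using R M0 Suc.prems by (intro mult_left_mono power_decreasing) auto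
    finally show ?case by simp
  qed
  from this[of n r] r show ?thesis by simp
qed

text \<open>With the sharp bound u = O(s^n), \<open>radial_step\<close> gives d = O(s^(n+1)), so the
  quotient \<open>y\<close> of \<open>u\<close> by \<open>s ^ n\<close> has a derivative of size
  O(s). Hence \<open>y\<close> has a limit \<open>C\<close> at 0 with an error of size O(s^2). If
  \<open>C = 0\<close>, this estimate improves itself: a bound \<open>A * s ^ n\<close> for
  \<open>u\<close> yields the same bound with \<open>A / 2\<close>, and iteration forces
  \<open>u = 0\<close>.\<close>

lemma radial_limit:
  fixes u d :: "real \<Rightarrow> 'a::banach"
  assumes R: "0 < R" "k\<^sup>2 * R\<^sup>2 \<le> 1/2"
    and u': "\<And>s. 0 < s \<Longrightarrow> s \<le> R \<Longrightarrow>
      ((\<lambda>s. inverse (s ^ n) *\<^sub>R u s) has_vector_derivative inverse (s ^ n) *\<^sub>R d s) (at s)"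
    and d': "\<And>s. 0 < s \<Longrightarrow> s \<le> R \<Longrightarrow>
      ((\<lambda>s. s ^ (n+1) *\<^sub>R d s) has_vector_derivative - (k\<^sup>2 * s ^ (n+1)) *\<^sub>R u s) (at s)"
    and uM: "\<And>s. 0 < s \<Longrightarrow> s \<le> R \<Longrightarrow> norm (u s) \<le> M"
    and dM: "\<And>s. 0 < s \<Longrightarrow> s \<le> R \<Longrightarrow> norm (d s) \<le> M'"
  obtains C K where "\<And>s. 0 < s \<Longrightarrow> s \<le> R \<Longrightarrow> norm (u s - s ^ n *\<^sub>R C) \<le> K * s ^ (n+2)"
    and "C = 0 \<Longrightarrow> (\<forall>s. 0 < s \<longrightarrow> s \<le> R \<longrightarrow> u s = 0)"
proof -
  define y where "y = (\<lambda>s. inverse (s ^ n) *\<^sub>R u s)"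
  define A0 where "A0 = 2 * M / R ^ n"
  have uA0: "norm (u s) \<le> A0 * s ^ n" if "0 < s" "s \<le> R" for s
  proof -
    have "norm (u s) \<le> 2 * M * (s / R) ^ n"
      by (rule radial_bound[OF R u' d' uM dM that])
    then show ?thesis by (simp add: A0_def power_divide)
  qed
  \<comment> \<open>Stated for an arbitrary \<open>A\<close> and not only for \<open>A0\<close>,
    because the case \<open>C = 0\<close> feeds ever smaller constants back into it.\<close>
  have lip: "norm (y t - y s) \<le> k\<^sup>2 * A * t * (t - s)"
    if A: "\<And>s. 0 < s \<Longrightarrow> s \<le> R \<Longrightarrow> norm (u s) \<le> A * s ^ n" and st: "0 < s" "s \<le> t" "t \<le> R" for A s t
  proof (rule vector_derivative_bound[OF st(2)])
    fix x assume x: "s \<le> x" "x \<le> t"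
    have An: "A \<ge> 0"
      using coeff_nonneg_of_norm_le[OF A[of s] st(1)] st by simp
    have x0: "0 < x" "x \<le> R" using x st by auto
    show "(y has_vector_derivative inverse (x ^ n) *\<^sub>R d x) (at x)"
      unfolding y_def using u'[OF x0] .
    have "norm (d x) \<le> k\<^sup>2 * A * x ^ (n+1)"
      by (rule radial_step[OF d' dM A x0])
    then have "norm (inverse (x ^ n) *\<^sub>R d x) \<le> inverse (x ^ n) * (k\<^sup>2 * A * x ^ (n+1))"
      using x0 by (simp add: mult_left_mono)
    also have "\<dots> = k\<^sup>2 * A * x" using x0 by simp
    also have "\<dots> \<le> k\<^sup>2 * A * t" using x An by (intro mult_left_mono) auto
    finally show "norm (inverse (x ^ n) *\<^sub>R d x) \<le> k\<^sup>2 * A * t" .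
  qed
  have A0n: "A0 \<ge> 0"
    using coeff_nonneg_of_norm_le[OF uA0[of R] R(1)] R by simp
  let ?z = "\<lambda>i::nat. R / real (Suc i)"
  have z0: "?z \<longlonglongrightarrow> 0"
    using tendsto_mult_right[OF LIMSEQ_inverse_real_of_nat, of R]
    by (simp add: divide_inverse mult.commute)
  have zR: "0 < ?z i" "?z i \<le> R" for i using R by (auto simp: field_simps)
  have lip': "dist (y t) (y s) \<le> k\<^sup>2 * A0 * R * dist t s" if "0 < s" "s \<le> R" "0 < t" "t \<le> R" for s t
  proof -
    have *: "dist (y t) (y s) \<le> k\<^sup>2 * A0 * R * dist t s" if st: "0 < s" "s \<le> t" "t \<le> R" for s t
    proof -
      have "dist (y t) (y s) \<le> k\<^sup>2 * A0 * t * (t - s)"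
        unfolding dist_norm by (rule lip[OF uA0 st])
      also have "\<dots> \<le> k\<^sup>2 * A0 * R * (t - s)"
        using st A0n by (intro mult_right_mono mult_left_mono) auto
      finally show ?thesis using st by (simp add: dist_norm)
    qed
    from *[of s t] *[of t s] that show ?thesis by (cases "s \<le> t") (auto simp: dist_commute)
  qed
  have "Cauchy (\<lambda>i. y (?z i))"
  proof (rule metric_CauchyI)
    fix e :: real assume e: "e > 0"
    \<comment> \<open>The summand 1 keeps the divisor positive even when the Lipschitz constant is
      0.\<close>
    define L where "L = k\<^sup>2 * A0 * R + 1"
    have L: "L > 0" using A0n R by (auto simp: L_def intro!: add_nonneg_pos mult_nonneg_nonneg)
    have "Cauchy ?z" using z0 by (rule LIMSEQ_imp_Cauchy)
    then obtain N where N: "\<And>m n. m \<ge> N \<Longrightarrow> n \<ge> N \<Longrightarrow> dist (?z m) (?z n) < e / L"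
      using metric_CauchyD[of ?z "e / L"] e L by auto
    show "\<exists>N. \<forall>m\<ge>N. \<forall>n\<ge>N. dist (y (?z m)) (y (?z n)) < e"
    proof (intro exI[of _ N] allI impI)
      fix m n assume mn: "N \<le> m" "N \<le> n"
      have "dist (y (?z m)) (y (?z n)) \<le> k\<^sup>2 * A0 * R * dist (?z m) (?z n)"
        by (rule lip'[OF zR zR])
      also have "\<dots> \<le> L * dist (?z m) (?z n)"
        by (intro mult_right_mono) (auto simp: L_def)
      also have "\<dots> < L * (e / L)"
        using N[OF mn] L by (simp only: mult_less_cancel_left_pos)
      finally show "dist (y (?z m)) (y (?z n)) < e" using L by simp
    qed
  qed
  then obtain C where C: "(\<lambda>i. y (?z i)) \<longlonglongrightarrow> C"
    using Cauchy_convergent convergent_def by blast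
  have yC: "norm (y t - C) \<le> k\<^sup>2 * A * t\<^sup>2"
    if A: "\<And>s. 0 < s \<Longrightarrow> s \<le> R \<Longrightarrow> norm (u s) \<le> A * s ^ n" and t: "0 < t" "t \<le> R" for A t
  proof (rule tendsto_le[OF sequentially_bot])
    show "(\<lambda>i. norm (y t - y (?z i))) \<longlonglongrightarrow> norm (y t - C)"
      by (intro tendsto_intros C)
    have "(\<lambda>i. k\<^sup>2 * A * t * (t - ?z i)) \<longlonglongrightarrow> k\<^sup>2 * A * t * (t - 0)"
      by (intro tendsto_intros z0)
    then show "(\<lambda>i. k\<^sup>2 * A * t * (t - ?z i)) \<longlonglongrightarrow> k\<^sup>2 * A * t\<^sup>2"
      by (simp add: power2_eq_square mult.assoc)
    have "\<forall>\<^sub>F i in sequentially. ?z i < t" using z0 t by (intro order_tendstoD)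
    then show "\<forall>\<^sub>F i in sequentially. norm (y t - y (?z i)) \<le> k\<^sup>2 * A * t * (t - ?z i)"
    proof eventually_elim
      case (elim i)
      show ?case by (rule lip[OF A zR(1) less_imp_le[OF elim] t(2)])
    qed
  qed
  have conv: "norm (u t - t ^ n *\<^sub>R C) = t ^ n * norm (y t - C)" if "0 < t" for t
  proof -
    have "u t - t ^ n *\<^sub>R C = t ^ n *\<^sub>R (y t - C)"
      using that by (simp add: y_def scaleR_diff_right)
    then show ?thesis using that by simp
  qed
  show thesis
  proof (rule that[of C "k\<^sup>2 * A0"])
    fix s assume s: "0 < s" "s \<le> R"
    have "norm (y s - C) \<le> k\<^sup>2 * A0 * s\<^sup>2" by (rule yC[OF uA0 s])
    then have "norm (u s - s ^ n *\<^sub>R C) \<le> s ^ n * (k\<^sup>2 * A0 * s\<^sup>2)"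
      unfolding conv[OF s(1)] using s by (intro mult_left_mono) auto
    then show "norm (u s - s ^ n *\<^sub>R C) \<le> k\<^sup>2 * A0 * s ^ (n + 2)"
      by (simp add: power_add mult_ac power2_eq_square)
  next
    assume C0: "C = 0"
    have it: "norm (u s) \<le> A0 * (1/2) ^ i * s ^ n" if "0 < s" "s \<le> R" for s i
      using that
    proof (induction i arbitrary: s)
      case 0
      then show ?case using uA0 by simp
    next
      case (Suc i)
      have yC': "norm (y s - C) \<le> k\<^sup>2 * (A0 * (1/2) ^ i) * s\<^sup>2"
        by (rule yC[OF Suc.IH Suc.prems])
      have "norm (u s) = s ^ n * norm (y s - C)" using conv[of s] Suc.prems C0 by simp
      also have "\<dots> \<le> s ^ n * (k\<^sup>2 * (A0 * (1/2) ^ i) * s\<^sup>2)"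
        by (rule mult_left_mono[OF yC']) (use Suc.prems in auto)
      also have "\<dots> = (k\<^sup>2 * s\<^sup>2) * (A0 * (1/2) ^ i * s ^ n)" by simp
      also have "\<dots> \<le> (1/2) * (A0 * (1/2) ^ i * s ^ n)"
      proof (rule mult_right_mono)
        have "k\<^sup>2 * s\<^sup>2 \<le> k\<^sup>2 * R\<^sup>2" using Suc.prems by (intro mult_left_mono power_mono) auto
        then show "k\<^sup>2 * s\<^sup>2 \<le> 1/2" using R by simp
      qed (use A0n Suc.prems in auto)
      finally show ?case by simp
    qed
    show "\<forall>s. 0 < s \<longrightarrow> s \<le> R \<longrightarrow> u s = 0"
    proof (intro allI impI)
      fix s assume s: "0 < s" "s \<le> R"
      have "(\<lambda>i. A0 * (1/2) ^ i * s ^ n) \<longlonglongrightarrow> A0 * 0 * s ^ n"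
        by (intro tendsto_intros LIMSEQ_power_zero) auto
      then have "norm (u s) \<le> A0 * 0 * s ^ n"
        using it[OF s] by (intro tendsto_lowerbound[of "\<lambda>i. A0 * (1/2) ^ i * s ^ n"]) auto
      then show "u s = 0" by simp
    qed
  qed
qed

section \<open>Fourier series on the unit circle\<close>

text \<open>A function on the circle is represented as a function of the unit complex number and not
  of the angle: periodicity is then automatic, and Stone-Weierstrass applies on the compact set
  \<open>sphere 0 1\<close>.\<close>

definition fourier_coeff :: "(complex \<Rightarrow> complex) \<Rightarrow> int \<Rightarrow> complex"
  where "fourier_coeff g m = integral {0..2*pi} (\<lambda>t. g (cis t) * cis (- (of_int m * t))) / (2 * pi)"

lemma continuous_on_circle_param:
  assumes "continuous_on (sphere 0 1) g"
  shows "continuous_on S (\<lambda>t. g (cis t) * cis (- (of_int m * t)))"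
proof -
  have "continuous_on S (\<lambda>t. g (cis t))"
    by (rule continuous_on_compose2[OF assms]) (auto intro!: continuous_intros)
  then show ?thesis by (intro continuous_intros)
qed

lemma integrable_fourier:
  assumes "continuous_on (sphere 0 1) g"
  shows "(\<lambda>t. g (cis t) * cis (- (of_int m * t))) integrable_on {0..2*pi}"
  by (intro integrable_continuous_real continuous_on_circle_param assms)

lemma fourier_coeff_add:
  assumes "continuous_on (sphere 0 1) g" "continuous_on (sphere 0 1) h"
  shows "fourier_coeff (\<lambda>z. g z + h z) m = fourier_coeff g m + fourier_coeff h m"
  using integral_add[OF integrable_fourier[OF assms(1), of m] integrable_fourier[OF assms(2), of m]]
  by (simp add: fourier_coeff_def ring_distribs add_divide_distrib)

lemma fourier_coeff_cmult: "fourier_coeff (\<lambda>z. c * g z) m = c * fourier_coeff g m"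
  by (simp add: fourier_coeff_def mult.assoc)

lemma fourier_coeff_diff:
  assumes "continuous_on (sphere 0 1) g" "continuous_on (sphere 0 1) h"
  shows "fourier_coeff (\<lambda>z. g z - h z) m = fourier_coeff g m - fourier_coeff h m"
  using integral_diff[OF integrable_fourier[OF assms(1), of m] integrable_fourier[OF assms(2), of m]]
  by (simp add: fourier_coeff_def ring_distribs diff_divide_distrib)

lemma fourier_coeff_sum:
  assumes "finite I" "\<And>i. i \<in> I \<Longrightarrow> continuous_on (sphere 0 1) (g i)"
  shows "fourier_coeff (\<lambda>z. \<Sum>i\<in>I. g i z) m = (\<Sum>i\<in>I. fourier_coeff (g i) m)"
  using assms
proof (induction I rule: finite_induct)
  case empty
  then show ?case by (simp add: fourier_coeff_def)
next
  case (insert i I)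
  then show ?case
    by (simp add: fourier_coeff_add continuous_on_sum)
qed

lemma norm_fourier_coeff_le:
  assumes "continuous_on (sphere 0 1) g" "\<And>z. z \<in> sphere 0 1 \<Longrightarrow> norm (g z) \<le> B"
  shows "norm (fourier_coeff g m) \<le> B"
proof -
  have "norm (integral {0..2*pi} (\<lambda>t. g (cis t) * cis (- (of_int m * t)))) \<le> B * (2*pi - 0)"
    by (rule integral_bound) (use assms in \<open>auto simp: norm_mult intro: continuous_on_circle_param\<close>)
  then show ?thesis by (simp add: fourier_coeff_def norm_divide field_simps)
qed

lemma has_vector_derivative_cis_mult:
  "((\<lambda>t. cis (a * t)) has_vector_derivative \<i> * a * cis (a * t)) (at t within S)"
proof -
  have "((\<lambda>z. exp (\<i> * of_real a * z)) has_field_derivative \<i> * a * exp (\<i> * of_real a * of_real t)) (at (of_real t))"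
    by (auto intro!: derivative_eq_intros)
  from has_vector_derivative_real_field[OF this] show ?thesis
    by (simp add: cis_conv_exp mult_ac)
qed

lemma fourier_coeff_power_int: "fourier_coeff (\<lambda>z. z powi k) m = (if k = m then 1 else 0)"
proof -
  have eq: "(\<lambda>t. cis t powi k * cis (- (of_int m * t))) = (\<lambda>t. cis (of_int (k - m) * t))"
    by (simp add: cis_power_int cis_mult algebra_simps)
  show ?thesis
  proof (cases "k = m")
    case True
    then show ?thesis unfolding fourier_coeff_def eq by (simp add: scaleR_conv_of_real)
  next
    case False
    define a :: real where "a = of_int (k - m)"
    have a: "a \<noteq> 0" using False by (simp add: a_def)
    have "((\<lambda>t. cis (a * t)) has_integral (cis (a * (2*pi)) / (\<i> * a) - cis (a * 0) / (\<i> * a))) {0..2*pi}"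
    proof (rule fundamental_theorem_of_calculus)
      fix t :: real
      show "((\<lambda>t. cis (a * t) / (\<i> * a)) has_vector_derivative cis (a * t)) (at t within {0..2*pi})"
        using has_vector_derivative_divide[OF has_vector_derivative_cis_mult[of a t], of "\<i> * a"] a by simp
    qed simp
    moreover have "cis (a * (2*pi)) = 1"
      using cis_multiple_2pi[of a] by (simp add: a_def mult_ac)
    ultimately have "integral {0..2*pi} (\<lambda>t. cis (a * t)) = 0"
      by (simp add: integral_unique)
    then show ?thesis
      using False unfolding fourier_coeff_def eq a_def[symmetric] by simp
  qed
qed

lemma fourier_coeff_mult_self:
  "fourier_coeff (\<lambda>z. z * g z) m = fourier_coeff g (m - 1)"
  "fourier_coeff (\<lambda>z. cnj z * g z) m = fourier_coeff g (m + 1)"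
proof -
  have "cis t * g (cis t) * cis (- (of_int m * t)) = g (cis t) * cis (- (of_int (m - 1) * t))" for t
  proof -
    have "cis t * cis (- (of_int m * t)) = cis (- (of_int (m - 1) * t))"
      by (simp add: cis_mult algebra_simps)
    then show ?thesis by (metis mult.commute mult.left_commute)
  qed
  then show "fourier_coeff (\<lambda>z. z * g z) m = fourier_coeff g (m - 1)"
    by (simp only: fourier_coeff_def)
  have "cnj (cis t) * g (cis t) * cis (- (of_int m * t)) = g (cis t) * cis (- (of_int (m + 1) * t))" for t
  proof -
    have "cnj (cis t) * cis (- (of_int m * t)) = cis (- (of_int (m + 1) * t))"
      by (simp add: cis_mult cis_cnj algebra_simps)
    then show ?thesis by (metis mult.commute mult.left_commute)
  qed
  then show "fourier_coeff (\<lambda>z. cnj z * g z) m = fourier_coeff g (m + 1)"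
    by (simp only: fourier_coeff_def)
qed

text \<open>Multiplication by \<open>z\<close> or \<open>cnj z\<close> only shifts the index, so it
  preserves the vanishing of all coefficients, and every real linear form is a combination
  \<open>\<alpha> * z + \<beta> * cnj z\<close>. The induction has to range over all
  \<open>g\<close>, since in the product case \<open>q * g\<close> takes the place of
  \<open>g\<close>.\<close>

lemma fourier_coeff_real_polynomial_mult:
  assumes "real_polynomial_function p" and "continuous_on (sphere 0 1) g" and "\<And>m. fourier_coeff g m = 0"
  shows "fourier_coeff (\<lambda>z. of_real (p z) * g z) m = 0"
  using assms
proof (induction p arbitrary: g m rule: real_polynomial_function.induct)
  case (linear p)
  define \<alpha> where "\<alpha> = (of_real (p 1) - \<i> * of_real (p \<i>)) / 2"
  define \<beta> where "\<beta> = (of_real (p 1) + \<i> * of_real (p \<i>)) / 2"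
  have p: "of_real (p z) = \<alpha> * z + \<beta> * cnj z" for z
  proof -
    have "p z = p (Re z *\<^sub>R 1 + Im z *\<^sub>R \<i>)"
      by (rule arg_cong[of _ _ p]) (simp add: complex_eq_iff)
    also have "\<dots> = Re z * p 1 + Im z * p \<i>"
      using linear.hyps by (simp only: linear_simps bounded_linear.linear linear_add linear_scale real_scaleR_def)
    finally show ?thesis by (simp add: \<alpha>_def \<beta>_def complex_eq_iff field_simps)
  qed
  have c: "continuous_on (sphere 0 1) (\<lambda>z. z * g z)" "continuous_on (sphere 0 1) (\<lambda>z. cnj z * g z)"
    using linear.prems by (auto intro!: continuous_intros)
  have "fourier_coeff (\<lambda>z. of_real (p z) * g z) m
      = fourier_coeff (\<lambda>z. \<alpha> * (z * g z) + \<beta> * (cnj z * g z)) m"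
    by (simp add: p algebra_simps)
  also have "\<dots> = 0"
    using linear.prems c
    by (subst fourier_coeff_add)
      (auto intro!: continuous_intros simp: fourier_coeff_cmult fourier_coeff_mult_self)
  finally show ?case .
next
  case (const c)
  then show ?case by (simp add: fourier_coeff_cmult)
next
  case (add p q)
  have "continuous_on (sphere 0 1) (\<lambda>z. of_real (p z) * g z)" "continuous_on (sphere 0 1) (\<lambda>z. of_real (q z) * g z)"
    using add.hyps[unfolded real_polynomial_function_eq, THEN continuous_on_polymonial_function] add.prems
    by (auto intro!: continuous_intros)
  then show ?case
    using add by (simp add: ring_distribs fourier_coeff_add)
next
  case (mult p q)
  have "continuous_on (sphere 0 1) (\<lambda>z. of_real (q z) * g z)"
    using mult.hyps[unfolded real_polynomial_function_eq, THEN continuous_on_polymonial_function] mult.prems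
    by (auto intro!: continuous_intros)
  then show ?case
    using mult.IH(1)[of "\<lambda>z. of_real (q z) * g z"] mult.IH(2) mult.prems
    by (simp add: mult.assoc)
qed

text \<open>Uniqueness: by Stone-Weierstrass \<open>cnj g\<close> is a uniform limit of polynomials \<open>q\<close> in \<open>Re z\<close>, \<open>Im z\<close>, and the
  vanishing coefficients force \<open>q * g\<close> to have mean zero.\<close>

lemma fourier_coeff_eq_0_imp:
  assumes g: "continuous_on (sphere 0 1) g" and g0: "\<And>m. fourier_coeff g m = 0" and z: "z \<in> sphere 0 1"
  shows "g z = 0"
proof -
  have "compact (g ` sphere 0 1)" using g by (intro compact_continuous_image) auto
  then obtain B where B: "\<And>z. z \<in> sphere 0 1 \<Longrightarrow> norm (g z) \<le> B"
    by (meson bounded_iff compact_imp_bounded imageI)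
  have B0: "B \<ge> 0" using B[OF z] norm_ge_zero order_trans by blast
  have small: "norm (fourier_coeff (\<lambda>z. cnj (g z) * g z) 0) \<le> e * B" if e: "e > 0" for e
  proof -
    have "continuous_on (sphere 0 1) (\<lambda>z. cnj (g z))" using g by (intro continuous_intros)
    then obtain q where q: "polynomial_function q" "\<And>z. z \<in> sphere 0 1 \<Longrightarrow> norm (cnj (g z) - q z) < e"
      using Stone_Weierstrass_polynomial_function[of "sphere 0 1" "\<lambda>z. cnj (g z)" e] e by auto
    have qc: "continuous_on (sphere 0 1) q" using q(1) by (rule continuous_on_polymonial_function)
    have qr: "real_polynomial_function (\<lambda>z. Re (q z))" "real_polynomial_function (\<lambda>z. Im (q z))"
      using q(1) bounded_linear_Re bounded_linear_Im
      unfolding polynomial_function_def o_def by blast+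
    have "fourier_coeff (\<lambda>z. q z * g z) 0 =
      fourier_coeff (\<lambda>z. of_real (Re (q z)) * g z + \<i> * (of_real (Im (q z)) * g z)) 0"
      by (subst complex_eq) (simp add: algebra_simps)
    also have "\<dots> = 0"
      using fourier_coeff_real_polynomial_mult[OF qr(1) g g0] fourier_coeff_real_polynomial_mult[OF qr(2) g g0] g qc
      by (subst fourier_coeff_add) (auto intro!: continuous_intros simp: fourier_coeff_cmult)
    finally have "fourier_coeff (\<lambda>z. (cnj (g z) - q z) * g z) 0 = fourier_coeff (\<lambda>z. cnj (g z) * g z) 0"
      using g qc by (simp add: left_diff_distrib fourier_coeff_diff continuous_intros)
    moreover have "norm (fourier_coeff (\<lambda>z. (cnj (g z) - q z) * g z) 0) \<le> e * B"
    proof (rule norm_fourier_coeff_le)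
      show "continuous_on (sphere 0 1) (\<lambda>z. (cnj (g z) - q z) * g z)"
        using g qc by (intro continuous_intros)
      show "norm ((cnj (g z) - q z) * g z) \<le> e * B" if "z \<in> sphere 0 1" for z
        unfolding norm_mult using q(2)[OF that] B[OF that] e by (intro mult_mono) auto
    qed
    ultimately show ?thesis by simp
  qed
  have "norm (fourier_coeff (\<lambda>z. cnj (g z) * g z) 0) \<le> 0 + e" if "e > 0" for e
  proof -
    have "e / (B + 1) * B \<le> e" using that B0 by (simp add: field_simps)
    then show ?thesis using small[of "e / (B+1)"] that B0 by auto
  qed
  then have "norm (fourier_coeff (\<lambda>z. cnj (g z) * g z) 0) \<le> 0" by (rule field_le_epsilon)
  then have I0: "integral {0..2*pi} (\<lambda>t. cnj (g (cis t)) * g (cis t)) = 0"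
    by (simp add: fourier_coeff_def)
  have gc: "continuous_on {0..2*pi} (\<lambda>t. g (cis t))"
    by (rule continuous_on_compose2[OF g]) (auto intro!: continuous_intros)
  have "(\<lambda>t. of_real ((norm (g (cis t)))\<^sup>2)) = (\<lambda>t. cnj (g (cis t)) * g (cis t))"
    by (simp only: complex_norm_square mult.commute)
  moreover have "integral {0..2*pi} (\<lambda>t. complex_of_real ((norm (g (cis t)))\<^sup>2))
      = of_real (integral {0..2*pi} (\<lambda>t. (norm (g (cis t)))\<^sup>2))"
    by (rule integral_unique, rule has_integral_of_real, rule integrable_integral)
      (intro integrable_continuous_real continuous_intros gc)
  ultimately have "integral {0..2*pi} (\<lambda>t. (norm (g (cis t)))\<^sup>2) = 0"
    using I0 by simp
  then have zero: "\<forall>t\<in>{0..2*pi}. (norm (g (cis t)))\<^sup>2 = 0"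
    by (subst (asm) integral_eq_0_iff) (auto intro!: continuous_intros gc)
  have "z = cis (Arg2pi z)"
    using z complex_norm_eq_1_exp[of z] by (simp add: cis_conv_exp)
  then show ?thesis
    using zero[rule_format, of "Arg2pi z"] Arg2pi_ge_0[of z] Arg2pi_lt_2pi[of z] by simp
qed

text \<open>The index set \<open>{int n, - int n}\<close> is a singleton for \<open>n = 0\<close>.\<close>

lemma fourier_remainder_bound:
  assumes g: "continuous_on (sphere 0 1) g"
    and A: "\<And>m. norm (fourier_coeff g m) \<le> A * q ^ nat \<bar>m\<bar>"
    and q: "0 \<le> q" "q \<le> 1/2" and z: "z \<in> sphere 0 1"
  shows "norm (g z - (\<Sum>n<K. \<Sum>m\<in>{int n, - int n}. fourier_coeff g m * z powi m)) \<le> 4 * A * q ^ K"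
proof -
  define T where "T = (\<lambda>n z. \<Sum>m\<in>{int n, - int n}. fourier_coeff g m * z powi m)"
  define P where "P = (\<lambda>K z. \<Sum>n<K. T n z)"
  have A0: "A \<ge> 0" using order_trans[OF norm_ge_zero A[of 0]] by simp
  have Tb: "norm (T n w) \<le> 2 * A * q ^ n" if w: "w \<in> sphere 0 1" for n w
  proof -
    have t: "norm (fourier_coeff g m * w powi m) \<le> A * q ^ nat \<bar>m\<bar>" for m
      using A[of m] w by (simp add: norm_mult norm_power_int)
    have "norm (T n w) \<le> (\<Sum>m\<in>{int n, - int n}. A * q ^ nat \<bar>m\<bar>)"
      unfolding T_def by (intro sum_norm_le t)
    also have "\<dots> \<le> 2 * A * q ^ n" using A0 q by (cases "n = 0") auto
    finally show ?thesis .
  qed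
  have geo: "(\<lambda>n. 2 * A * q ^ n) sums (2 * A * (1 / (1 - q)))"
    using q by (intro sums_mult geometric_sums) auto
  have Tc: "continuous_on (sphere 0 1) (T n)" for n
    unfolding T_def by (intro continuous_intros) auto
  have Pc: "continuous_on (sphere 0 1) (P n)" for n
    unfolding P_def by (intro continuous_intros Tc)
  have ul: "uniform_limit (sphere 0 1) P (\<lambda>z. \<Sum>n. T n z) sequentially"
    unfolding P_def by (rule Weierstrass_m_test[OF Tb]) (use geo in \<open>auto simp: sums_iff\<close>)
  \<comment> \<open>The Fourier series of a merely continuous function need not converge. Here the
    decay of the coefficients yields a uniform limit \<open>S\<close>; its coefficients are those of
    \<open>g\<close>, because \<open>P K\<close> already has the right \<open>m\<close>-th
    coefficient once \<open>K\<close> exceeds \<open>\<bar>m\<bar>\<close>. Uniqueness then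
    identifies \<open>S\<close> with \<open>g\<close>.\<close>
  define S where "S = (\<lambda>z. \<Sum>n. T n z)"
  have Sc: "continuous_on (sphere 0 1) S"
    unfolding S_def by (rule uniform_limit_theorem[OF _ ul]) (auto intro: Pc always_eventually)
  have tail: "norm (S w - P K w) \<le> 4 * A * q ^ K" if w: "w \<in> sphere 0 1" for K w
  proof -
    have sm: "summable (\<lambda>n. T n w)"
      by (rule summable_comparison_test'[of "\<lambda>n. 2 * A * q ^ n" 0]) (use geo Tb[OF w] in \<open>auto simp: sums_iff\<close>)
    have "S w - P K w = (\<Sum>n. T (n + K) w)"
      unfolding S_def P_def using suminf_minus_initial_segment[OF sm, of K] by simp
    also have "norm \<dots> \<le> (\<Sum>n. 2 * A * q ^ K * q ^ n)"
    proof (rule norm_suminf_le)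
      show "norm (T (n + K) w) \<le> 2 * A * q ^ K * q ^ n" for n
        using Tb[OF w, of "n + K"] by (simp add: power_add mult_ac)
      show "summable (\<lambda>n. 2 * A * q ^ K * q ^ n)"
        using q by (intro summable_mult summable_geometric) auto
    qed
    also have "\<dots> = 2 * A * q ^ K * (1 / (1 - q))"
      using q by (subst suminf_mult) (auto simp: suminf_geometric)
    \<comment> \<open>Origin of the constant 4: one factor 2 comes from the two indices in
      \<open>T n\<close>, the other from \<open>1 / (1 - q) \<le> 2\<close>.\<close>
    also have "\<dots> \<le> 2 * A * q ^ K * 2"
      using q A0 by (intro mult_left_mono) (auto simp: field_simps)
    finally show ?thesis by simp
  qed
  have cT: "fourier_coeff (T n) m = (if n = nat \<bar>m\<bar> then fourier_coeff g m else 0)" for n m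
  proof -
    have "fourier_coeff (T n) m = (\<Sum>j\<in>{int n, - int n}. fourier_coeff g j * (if j = m then 1 else 0))"
      unfolding T_def
      by (subst fourier_coeff_sum)
        (auto intro!: continuous_intros simp: fourier_coeff_cmult fourier_coeff_power_int)
    also have "\<dots> = (if m \<in> {int n, - int n} then fourier_coeff g m else 0)"
      by (cases "n = 0") auto
    also have "m \<in> {int n, - int n} \<longleftrightarrow> n = nat \<bar>m\<bar>" by auto
    finally show ?thesis .
  qed
  have cP: "fourier_coeff (P K) m = (if nat \<bar>m\<bar> < K then fourier_coeff g m else 0)" for K m
    unfolding P_def by (subst fourier_coeff_sum) (auto simp: Tc cT)
  have S0: "fourier_coeff (\<lambda>z. g z - S z) m = 0" for m
  proof -
    have lim: "(\<lambda>K. 4 * A * q ^ K) \<longlonglongrightarrow> 4 * A * 0"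
      using q by (intro tendsto_intros LIMSEQ_power_zero) auto
    have "norm (fourier_coeff (\<lambda>z. g z - S z) m) \<le> 4 * A * 0"
    proof (rule tendsto_lowerbound[OF lim])
      show "\<forall>\<^sub>F K in sequentially. norm (fourier_coeff (\<lambda>z. g z - S z) m) \<le> 4 * A * q ^ K"
        using eventually_gt_at_top[of "nat \<bar>m\<bar>"]
      proof eventually_elim
        case (elim K)
        have "fourier_coeff (\<lambda>z. S z - P K z) m = fourier_coeff S m - fourier_coeff g m"
          using elim by (simp add: fourier_coeff_diff Sc Pc cP)
        moreover have "norm (fourier_coeff (\<lambda>z. S z - P K z) m) \<le> 4 * A * q ^ K"
          by (rule norm_fourier_coeff_le) (use tail Sc Pc in \<open>auto intro!: continuous_intros\<close>)
        ultimately show ?case by (simp add: fourier_coeff_diff Sc g norm_minus_commute)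
      qed
    qed auto
    then show ?thesis by simp
  qed
  have "g z - S z = 0"
    by (rule fourier_coeff_eq_0_imp[OF _ S0 z]) (intro continuous_intros g Sc)
  with tail[OF z, of K] show ?thesis by (simp add: P_def T_def)
qed

lemma fourier_coeff_cong:
  assumes "\<And>z. z \<in> sphere 0 1 \<Longrightarrow> g z = h z"
  shows "fourier_coeff g m = fourier_coeff h m"
  unfolding fourier_coeff_def using assms by (simp add: norm_mult)

section \<open>Local expansion of solutions\<close>

text \<open>The partial derivatives are arguments, so that a combination such as
  \<open>fx + \<sigma> * \<i> * fy\<close> can be given a gradient of its own and enter the ladder
  lemma a second time. The differential is only real-linear: \<open>f\<close> is not meant to be
  holomorphic.\<close>

definition C1_grad :: "complex set \<Rightarrow> (complex \<Rightarrow> complex) \<Rightarrow> (complex \<Rightarrow> complex) \<Rightarrow> (complex \<Rightarrow> complex) \<Rightarrow> bool"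
  where "C1_grad S f fx fy \<longleftrightarrow> continuous_on S fx \<and> continuous_on S fy \<and>
    (\<forall>z\<in>S. (f has_derivative (\<lambda>h. of_real (Re h) * fx z + of_real (Im h) * fy z)) (at z))"

lemma C1_grad_continuous: "C1_grad S f fx fy \<Longrightarrow> continuous_on S f"
  unfolding C1_grad_def by (meson has_derivative_continuous continuous_at_imp_continuous_on)

lemma C1_grad_lincomb:
  assumes "C1_grad S f fx fy" "C1_grad S g gx gy"
  shows "C1_grad S (\<lambda>z. f z + c * g z) (\<lambda>z. fx z + c * gx z) (\<lambda>z. fy z + c * gy z)"
  unfolding C1_grad_def
proof (intro conjI ballI)
  show "continuous_on S (\<lambda>z. fx z + c * gx z)" "continuous_on S (\<lambda>z. fy z + c * gy z)"
    using assms unfolding C1_grad_def by (auto intro!: continuous_intros)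
  fix z assume z: "z \<in> S"
  have "((\<lambda>z. f z + c * g z) has_derivative (\<lambda>h. (of_real (Re h) * fx z + of_real (Im h) * fy z)
      + c * (of_real (Re h) * gx z + of_real (Im h) * gy z))) (at z)"
    using assms z unfolding C1_grad_def by (intro has_derivative_add has_derivative_mult_right) auto
  then show "((\<lambda>z. f z + c * g z) has_derivative (\<lambda>h. of_real (Re h) * (fx z + c * gx z)
      + of_real (Im h) * (fy z + c * gy z))) (at z)"
    by (simp add: algebra_simps)
qed

lemma cis_scaled_in_ball: "0 \<le> r \<Longrightarrow> r < \<rho> \<Longrightarrow> of_real r * cis t \<in> ball 0 \<rho>"
  by (simp add: norm_mult)

lemma C1_grad_radial_derivative:
  assumes f: "C1_grad (ball 0 \<rho>) f fx fy" and r: "0 \<le> r" "r < \<rho>"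
  shows "((\<lambda>r. f (of_real r * cis t)) has_vector_derivative
    (of_real (cos t) * fx (of_real r * cis t) + of_real (sin t) * fy (of_real r * cis t))) (at r within S)"
proof -
  have "(f has_derivative (\<lambda>h. of_real (Re h) * fx (of_real r * cis t) + of_real (Im h) * fy (of_real r * cis t)))
      (at (of_real r * cis t))"
    using f cis_scaled_in_ball[OF r] unfolding C1_grad_def by blast
  then have "((\<lambda>r. f (of_real r * cis t)) has_derivative
     (\<lambda>h. of_real (Re (of_real h * cis t)) * fx (of_real r * cis t) + of_real (Im (of_real h * cis t)) * fy (of_real r * cis t)))
      (at r within S)"
    by (rule has_derivative_compose[rotated]) (auto intro!: derivative_eq_intros)
  then show ?thesis
    by (simp add: has_vector_derivative_def scaleR_conv_of_real algebra_simps)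
qed

lemma C1_grad_angular_derivative:
  assumes f: "C1_grad (ball 0 \<rho>) f fx fy" and r: "0 \<le> r" "r < \<rho>"
  shows "((\<lambda>t. f (of_real r * cis t)) has_vector_derivative
    of_real r * (of_real (cos t) * fy (of_real r * cis t) - of_real (sin t) * fx (of_real r * cis t))) (at t within S)"
proof -
  have "(f has_derivative (\<lambda>h. of_real (Re h) * fx (of_real r * cis t) + of_real (Im h) * fy (of_real r * cis t)))
      (at (of_real r * cis t))"
    using f cis_scaled_in_ball[OF r] unfolding C1_grad_def by blast
  moreover have "((\<lambda>t. of_real r * cis t) has_derivative (\<lambda>h. of_real h * (of_real r * (\<i> * cis t)))) (at t within S)"
    using has_vector_derivative_mult_right[OF has_vector_derivative_cis_mult[of 1 t S], of "of_real r"]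
    by (simp add: has_vector_derivative_def scaleR_conv_of_real)
  ultimately have "((\<lambda>t. f (of_real r * cis t)) has_derivative
     (\<lambda>h. of_real (Re (of_real h * (of_real r * (\<i> * cis t)))) * fx (of_real r * cis t)
       + of_real (Im (of_real h * (of_real r * (\<i> * cis t)))) * fy (of_real r * cis t)))
      (at t within S)"
    by (rule has_derivative_compose[rotated])
  then show ?thesis
    by (simp add: has_vector_derivative_def scaleR_conv_of_real algebra_simps)
qed

lemma continuous_on_circle_dilation:
  fixes f :: "complex \<Rightarrow> 'a::topological_space"
  assumes "continuous_on (ball 0 \<rho>) f" "0 \<le> r" "r < \<rho>"
  shows "continuous_on (sphere 0 1) (\<lambda>z. f (of_real r * z))"
  by (rule continuous_on_compose2[OF assms(1)]) (use assms in \<open>auto intro!: continuous_intros simp: norm_mult\<close>)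

text \<open>On circles, multiplying by \<open>cis (\<sigma> * t)\<close> shifts the Fourier index; hence the Wirtinger-type operator
  \<open>\<partial>\<^sub>x + \<sigma> * \<i> * \<partial>\<^sub>y\<close> maps the \<open>m\<close>-th coefficient to the \<open>(m + \<sigma>)\<close>-th. Applying the lemma
  with \<open>\<sigma>\<close> and then with \<open>- \<sigma>\<close> recovers the Laplacian.\<close>

lemma fourier_coeff_ladder:
  assumes f: "C1_grad (ball 0 \<rho>) f fx fy" and r: "0 < r" "r < \<rho>"
    and \<sigma>: "\<sigma> = 1 \<or> \<sigma> = (-1::int)"
  shows "((\<lambda>r. fourier_coeff (\<lambda>z. f (of_real r * z)) m) has_vector_derivative
    fourier_coeff (\<lambda>z. fx (of_real r * z) + of_int \<sigma> * \<i> * fy (of_real r * z)) (m + \<sigma>)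
      + of_int (\<sigma> * m) / of_real r * fourier_coeff (\<lambda>z. f (of_real r * z)) m) (at r)"
proof -
  have fc: "continuous_on (ball 0 \<rho>) f" "continuous_on (ball 0 \<rho>) fx" "continuous_on (ball 0 \<rho>) fy"
    using f C1_grad_continuous[OF f] unfolding C1_grad_def by auto
  let ?c = "\<lambda>t. cis (- (of_int m * t))"
  define X where "X = (\<lambda>r t. fx (of_real r * cis t) * ?c t)"
  define Y where "Y = (\<lambda>r t. fy (of_real r * cis t) * ?c t)"
  define G where "G = (\<lambda>r t. f (of_real r * cis t) * ?c t)"
  have cont: "continuous_on ({0<..<\<rho>} \<times> cbox 0 (2*pi)) (\<lambda>(r, t). g (of_real r * cis t))"
    if "continuous_on (ball 0 \<rho>) g" for g :: "complex \<Rightarrow> complex"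
    unfolding split_beta
    by (rule continuous_on_compose2[OF that]) (auto intro!: continuous_intros simp: norm_mult)
  have cont1: "continuous_on A (\<lambda>t. g (of_real r * cis t))"
    if "continuous_on (ball 0 \<rho>) g" for g :: "complex \<Rightarrow> complex" and A
    by (rule continuous_on_compose2[OF that]) (use r in \<open>auto intro!: continuous_intros simp: norm_mult\<close>)
  have intX: "(\<lambda>t. of_real (cos t) * X r t + of_real (sin t) * Y r t) integrable_on {0..2*pi}"
    and intY: "(\<lambda>t. of_real (cos t) * Y r t - of_real (sin t) * X r t) integrable_on {0..2*pi}"
    and intG: "G r integrable_on {0..2*pi}"
    unfolding X_def Y_def G_def
    by (intro integrable_continuous_real continuous_intros cont1 fc)+
  have deriv: "((\<lambda>r. integral (cbox 0 (2*pi)) (G r)) has_vector_derivative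
      integral (cbox 0 (2*pi)) (\<lambda>t. of_real (cos t) * X r t + of_real (sin t) * Y r t)) (at r within {0<..<\<rho>})"
  proof (rule leibniz_rule_vector_derivative[where fx = "\<lambda>r t. of_real (cos t) * X r t + of_real (sin t) * Y r t"])
    fix s t assume "s \<in> {0<..<\<rho>}" "t \<in> cbox 0 (2*pi)"
    then have "((\<lambda>r. f (of_real r * cis t) * ?c t) has_vector_derivative
        (of_real (cos t) * fx (of_real s * cis t) + of_real (sin t) * fy (of_real s * cis t)) * ?c t) (at s within {0<..<\<rho>})"
      by (intro has_vector_derivative_mult_left C1_grad_radial_derivative[OF f]) auto
    then show "((\<lambda>r. G r t) has_vector_derivative of_real (cos t) * X s t + of_real (sin t) * Y s t) (at s within {0<..<\<rho>})"
      by (simp add: G_def X_def Y_def algebra_simps)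
  next
    fix s assume s: "s \<in> {0<..<\<rho>}"
    have "continuous_on (cbox 0 (2*pi)) (\<lambda>t. f (of_real s * cis t))"
      by (rule continuous_on_compose2[OF fc(1)]) (use s in \<open>auto intro!: continuous_intros simp: norm_mult\<close>)
    then show "G s integrable_on cbox 0 (2*pi)"
      unfolding G_def by (intro integrable_continuous continuous_intros)
  next
    show "continuous_on ({0<..<\<rho>} \<times> cbox 0 (2*pi)) (\<lambda>(r, t). of_real (cos t) * X r t + of_real (sin t) * Y r t)"
      using cont[OF fc(2)] cont[OF fc(3)] unfolding X_def Y_def split_beta
      by (intro continuous_intros)
  qed (use r in auto)
  \<comment> \<open>Integration by parts over a full period: the boundary terms cancel because
    \<open>m\<close> is an integer, and the angular derivative becomes multiplication by
    \<open>\<i> * m\<close>.\<close>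
  have parts: "integral {0..2*pi} (\<lambda>t. of_real (cos t) * Y r t - of_real (sin t) * X r t)
      = \<i> * of_int m / of_real r * integral {0..2*pi} (G r)"
  proof -
    have "((\<lambda>t. of_real r * (of_real (cos t) * Y r t - of_real (sin t) * X r t) - \<i> * of_int m * G r t)
        has_integral (G r (2*pi) - G r 0)) {0..2*pi}"
    proof (rule fundamental_theorem_of_calculus)
      fix t :: real
      have c: "(?c has_vector_derivative \<i> * of_real (- of_int m) * ?c t) (at t within {0..2*pi})"
        using has_vector_derivative_cis_mult[of "- of_int m" t] by simp
      show "(G r has_vector_derivative (of_real r * (of_real (cos t) * Y r t - of_real (sin t) * X r t) - \<i> * of_int m * G r t))
          (at t within {0..2*pi})"
        unfolding G_def
        using has_vector_derivative_mult[OF C1_grad_angular_derivative[OF f, of r t "{0..2*pi}"] c] r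
        by (simp add: X_def Y_def algebra_simps)
    qed simp
    moreover have "cis (- (of_int m * (2*pi))) = 1"
      using cis_multiple_2pi[of "- of_int m"] by (simp add: mult_ac)
    then have "G r (2*pi) = G r 0" by (simp add: G_def)
    ultimately have "0 = integral {0..2*pi} (\<lambda>t. of_real r * (of_real (cos t) * Y r t - of_real (sin t) * X r t) - \<i> * of_int m * G r t)"
      by (simp add: integral_unique)
    also have "\<dots> = of_real r * integral {0..2*pi} (\<lambda>t. of_real (cos t) * Y r t - of_real (sin t) * X r t)
        - \<i> * of_int m * integral {0..2*pi} (G r)"
      by (subst integral_diff) (use intY intG in \<open>auto intro: integrable_on_mult_right simp: integrable_on_cmult_left\<close>)
    finally show ?thesis using r by (simp add: field_simps)
  qed
  \<comment> \<open>Polar form of the operator: after the shift by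
    \<open>cis (- (\<sigma> * t))\<close>, \<open>fx + \<sigma> * \<i> * fy\<close> is the radial
    derivative plus \<open>\<sigma> * \<i> / r\<close> times the angular one. The identity uses
    \<open>\<sigma> * \<sigma> = 1\<close>.\<close>
  have E: "(fx (of_real r * cis t) + of_int \<sigma> * \<i> * fy (of_real r * cis t)) * cis (- (of_int (m + \<sigma>) * t))
      = (of_real (cos t) * X r t + of_real (sin t) * Y r t)
        + of_int \<sigma> * \<i> * (of_real (cos t) * Y r t - of_real (sin t) * X r t)" for t
  proof -
    have e: "cis (- (of_int (m + \<sigma>) * t)) = (of_real (cos t) - of_int \<sigma> * \<i> * of_real (sin t)) * ?c t"
    proof -
      have "cis (- (of_int (m + \<sigma>) * t)) = cis (- (of_int \<sigma> * t)) * ?c t"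
        by (simp add: cis_mult algebra_simps)
      also have "cis (- (of_int \<sigma> * t)) = of_real (cos t) - of_int \<sigma> * \<i> * of_real (sin t)"
        using \<sigma> by (auto simp: complex_eq_iff)
      finally show ?thesis .
    qed
    show ?thesis unfolding e X_def Y_def using \<sigma> by (auto simp: algebra_simps)
  qed
  have "fourier_coeff (\<lambda>z. fx (of_real r * z) + of_int \<sigma> * \<i> * fy (of_real r * z)) (m + \<sigma>)
     = (integral {0..2*pi} (\<lambda>t. of_real (cos t) * X r t + of_real (sin t) * Y r t)
       + of_int \<sigma> * \<i> * integral {0..2*pi} (\<lambda>t. of_real (cos t) * Y r t - of_real (sin t) * X r t)) / (2*pi)"
    unfolding fourier_coeff_def E
    by (subst integral_add) (use intX intY in \<open>auto intro: integrable_on_mult_right\<close>)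
  also have "\<dots> = integral {0..2*pi} (\<lambda>t. of_real (cos t) * X r t + of_real (sin t) * Y r t) / (2*pi)
       - of_int (\<sigma> * m) / of_real r * fourier_coeff (\<lambda>z. f (of_real r * z)) m"
    unfolding parts by (simp add: fourier_coeff_def G_def field_simps)
  finally have eq: "integral {0..2*pi} (\<lambda>t. of_real (cos t) * X r t + of_real (sin t) * Y r t) / (2*pi)
      = fourier_coeff (\<lambda>z. fx (of_real r * z) + of_int \<sigma> * \<i> * fy (of_real r * z)) (m + \<sigma>)
      + of_int (\<sigma> * m) / of_real r * fourier_coeff (\<lambda>z. f (of_real r * z)) m" by simp
  have "at r within {0<..<\<rho>} = at r" using r by (intro at_within_open) auto
  with deriv have "((\<lambda>r. integral {0..2*pi} (G r)) has_vector_derivative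
      integral {0..2*pi} (\<lambda>t. of_real (cos t) * X r t + of_real (sin t) * Y r t)) (at r)"
    by (simp only: cbox_interval)
  from has_vector_derivative_divide[OF this, of "2*pi"] show ?thesis
    unfolding eq by (simp only: fourier_coeff_def G_def)
qed

section \<open>The Bessel system and the expansion in a disc\<close>

text \<open>Two radii are needed: regularity holds in the open disc of radius \<open>\<rho>\<close>,
  whereas the estimates run up to and including \<open>R < \<rho>\<close>, where \<open>f\<close>
  and its gradient are bounded by compactness and radial derivatives are still two-sided.\<close>

locale helmholtz_disc =
  fixes f fx fy fxx fxy fyx fyy :: "complex \<Rightarrow> complex" and k \<rho> R :: real
  assumes f: "C1_grad (ball 0 \<rho>) f fx fy"
    and fx: "C1_grad (ball 0 \<rho>) fx fxx fxy"
    and fy: "C1_grad (ball 0 \<rho>) fy fyx fyy"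
    and helmholtz: "\<And>z. z \<in> ball 0 \<rho> \<Longrightarrow> fxx z + fyy z + of_real (k\<^sup>2) * f z = 0"
    and mixed: "\<And>z. z \<in> ball 0 \<rho> \<Longrightarrow> fxy z = fyx z"
    and R: "0 < R" "R < \<rho>" "k\<^sup>2 * R\<^sup>2 \<le> 1/2"
begin

definition circle_coeff :: "int \<Rightarrow> real \<Rightarrow> complex"
  where "circle_coeff m r = fourier_coeff (\<lambda>z. f (of_real r * z)) m"

definition gradient_coeff :: "int \<Rightarrow> int \<Rightarrow> real \<Rightarrow> complex"
  where "gradient_coeff \<sigma> m r = fourier_coeff (\<lambda>z. fx (of_real r * z) + of_int \<sigma> * \<i> * fy (of_real r * z)) m"

lemma dilation_in_ball: "(z::complex) \<in> sphere 0 1 \<Longrightarrow> 0 < r \<Longrightarrow> r < \<rho> \<Longrightarrow> of_real r * z \<in> ball 0 \<rho>"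
  by (simp add: norm_mult)

text \<open>With \<open>\<sigma>\<close> the sign of the index, the ladder step raises the absolute
  index and \<open>\<sigma> * m\<close> equals \<open>n\<close>, so modes of both signs obey the
  same system. The factor \<open>inverse (s ^ n)\<close> absorbs the term \<open>n / s\<close> of
  the ladder formula.\<close>

lemma circle_coeff_derivative:
  assumes \<sigma>: "\<sigma> = 1 \<or> \<sigma> = -1" and s: "0 < s" "s \<le> R"
  shows "((\<lambda>s. inverse (s ^ n) *\<^sub>R circle_coeff (\<sigma> * int n) s) has_vector_derivative
    inverse (s ^ n) *\<^sub>R gradient_coeff \<sigma> (\<sigma> * int (n + 1)) s) (at s)"
proof -
  have circle_coeff': "(circle_coeff (\<sigma> * int n) has_vector_derivative gradient_coeff \<sigma> (\<sigma> * int (n + 1)) s + of_nat n / of_real s * circle_coeff (\<sigma> * int n) s) (at s)"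
    using fourier_coeff_ladder[OF f s(1) _ \<sigma>, of "\<sigma> * int n"] s R \<sigma>
    unfolding circle_coeff_def[abs_def] gradient_coeff_def by (auto simp: algebra_simps)
  have p: "((\<lambda>s. inverse (s ^ n)) has_field_derivative - (real n * inverse (s ^ n) / s)) (at s)"
  proof -
    have "((\<lambda>s. s ^ n) has_field_derivative real n * s ^ n / s) (at s)"
      using DERIV_pow[of n s UNIV] s by (cases n) auto
    from DERIV_inverse_fun[OF this] show ?thesis using s by (simp add: field_simps)
  qed
  show ?thesis
    using has_vector_derivative_scaleR[OF p circle_coeff'] s
    by (simp add: scaleR_conv_of_real field_simps)
qed

text \<open>The ladder step with \<open>- \<sigma>\<close> leads back to the index
  \<open>\<sigma> * n\<close>. In the composed operator the cross terms cancel by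
  \<open>mixed\<close>, and the remaining Laplacian is replaced by \<open>- k\<^sup>2 * f\<close>;
  the factor \<open>s ^ (n + 1)\<close> absorbs the zeroth-order term.\<close>

lemma gradient_coeff_derivative:
  assumes \<sigma>: "\<sigma> = 1 \<or> \<sigma> = -1" and s: "0 < s" "s \<le> R"
  shows "((\<lambda>s. s ^ (n + 1) *\<^sub>R gradient_coeff \<sigma> (\<sigma> * int (n + 1)) s) has_vector_derivative
    - (k\<^sup>2 * s ^ (n + 1)) *\<^sub>R circle_coeff (\<sigma> * int n) s) (at s)"
proof -
  define m where "m = \<sigma> * int (n + 1)"
  have m: "m - \<sigma> = \<sigma> * int n" "- \<sigma> * m = - int (n + 1)"
    using \<sigma> by (auto simp: m_def)
  note D = C1_grad_lincomb[OF fx fy, of "of_int \<sigma> * \<i>"]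
  have "fourier_coeff (\<lambda>z. (fxx (of_real s * z) + of_int \<sigma> * \<i> * fyx (of_real s * z)) + of_int (- \<sigma>) * \<i> *
        (fxy (of_real s * z) + of_int \<sigma> * \<i> * fyy (of_real s * z))) (m + - \<sigma>)
      = fourier_coeff (\<lambda>z. - of_real (k\<^sup>2) * f (of_real s * z)) (m + - \<sigma>)"
  proof (rule fourier_coeff_cong)
    fix z :: complex assume "z \<in> sphere 0 1"
    then have z: "of_real s * z \<in> ball 0 \<rho>" using dilation_in_ball s R by simp
    have "- of_real (k\<^sup>2) * f (of_real s * z) = fxx (of_real s * z) + fyy (of_real s * z)"
      using helmholtz[OF z] by (simp add: add_eq_0_iff)
    then show "(fxx (of_real s * z) + of_int \<sigma> * \<i> * fyx (of_real s * z)) + of_int (- \<sigma>) * \<i> *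
        (fxy (of_real s * z) + of_int \<sigma> * \<i> * fyy (of_real s * z)) = - of_real (k\<^sup>2) * f (of_real s * z)"
      using mixed[OF z] \<sigma> by (auto simp: algebra_simps)
  qed
  then have E: "fourier_coeff (\<lambda>z. (fxx (of_real s * z) + of_int \<sigma> * \<i> * fyx (of_real s * z)) + of_int (- \<sigma>) * \<i> *
        (fxy (of_real s * z) + of_int \<sigma> * \<i> * fyy (of_real s * z))) (m + - \<sigma>)
      = - of_real (k\<^sup>2) * circle_coeff (\<sigma> * int n) s"
    using m by (simp only: fourier_coeff_cmult circle_coeff_def) simp
  have \<sigma>': "- \<sigma> = 1 \<or> - \<sigma> = -1" using \<sigma> by auto
  have sR: "s < \<rho>" using s R by simp
  have "(gradient_coeff \<sigma> m has_vector_derivative - of_real (k\<^sup>2) * circle_coeff (\<sigma> * int n) s + of_int (- \<sigma> * m) / of_real s * gradient_coeff \<sigma> m s) (at s)"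
    using fourier_coeff_ladder[OF D s(1) sR \<sigma>', of m, unfolded E] by (simp only: gradient_coeff_def[abs_def])
  moreover have "of_int (- \<sigma> * m) / of_real s = - (of_nat (n + 1) / complex_of_real s)"
    unfolding m by (simp add: minus_divide_left)
  ultimately have gradient_coeff': "(gradient_coeff \<sigma> m has_vector_derivative - of_real (k\<^sup>2) * circle_coeff (\<sigma> * int n) s - of_nat (n + 1) / of_real s * gradient_coeff \<sigma> m s) (at s)"
    by (simp only: minus_mult_left[symmetric] diff_conv_add_uminus)
  have p: "((\<lambda>s. s ^ (n + 1)) has_field_derivative (real (n + 1) * s ^ n)) (at s)"
    using DERIV_pow[of "n + 1" s UNIV] by simp
  show ?thesis
    using has_vector_derivative_scaleR[OF p gradient_coeff'] s
    by (simp add: scaleR_conv_of_real m_def field_simps)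
qed

lemma bounded_on_disc:
  fixes g :: "complex \<Rightarrow> complex"
  assumes "continuous_on (ball 0 \<rho>) g"
  obtains M :: real where "\<And>r z. 0 < r \<Longrightarrow> r \<le> R \<Longrightarrow> z \<in> sphere 0 1 \<Longrightarrow> norm (g (of_real r * z)) \<le> M"
proof -
  have "compact (g ` cball 0 R)"
    using R by (intro compact_continuous_image continuous_on_subset[OF assms]) auto
  then obtain M where "\<And>z. z \<in> cball 0 R \<Longrightarrow> norm (g z) \<le> M"
    by (meson bounded_iff compact_imp_bounded imageI)
  then show thesis by (intro that[of M]) (auto simp: norm_mult)
qed

text \<open>\<open>M\<close> is one constant for all indices, as the remainder estimate for the
  whole series requires; \<open>C\<close> and \<open>K\<close> depend on the index.\<close>

lemma coeff_asymptotics: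
  obtains M C K where
    "\<And>m r. 0 < r \<Longrightarrow> r \<le> R \<Longrightarrow> norm (circle_coeff m r) \<le> 2 * M * (r / R) ^ nat \<bar>m\<bar>"
    "\<And>m r. 0 < r \<Longrightarrow> r \<le> R \<Longrightarrow> norm (circle_coeff m r - r ^ nat \<bar>m\<bar> *\<^sub>R C m) \<le> K m * r ^ (nat \<bar>m\<bar> + 2)"
    "\<And>m r. C m = 0 \<Longrightarrow> 0 < r \<Longrightarrow> r \<le> R \<Longrightarrow> circle_coeff m r = 0"
proof -
  have cont: "continuous_on (ball 0 \<rho>) f" "continuous_on (ball 0 \<rho>) (\<lambda>z. fx z + of_int \<sigma> * \<i> * fy z)" for \<sigma>
    using C1_grad_continuous[OF f] C1_grad_continuous[OF fx] C1_grad_continuous[OF fy]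
    by (auto intro!: continuous_intros)
  obtain M where M: "\<And>r z. 0 < r \<Longrightarrow> r \<le> R \<Longrightarrow> z \<in> sphere 0 1 \<Longrightarrow> norm (f (of_real r * z)) \<le> M"
    using bounded_on_disc[OF cont(1)] by blast
  have FM: "norm (circle_coeff m r) \<le> M" if "0 < r" "r \<le> R" for m r
    unfolding circle_coeff_def using that R M
    by (intro norm_fourier_coeff_le continuous_on_circle_dilation[OF cont(1)]) auto
  have "\<exists>M'. \<forall>m r. 0 < r \<longrightarrow> r \<le> R \<longrightarrow> norm (gradient_coeff \<sigma> m r) \<le> M'" for \<sigma>
  proof -
    obtain M' where "\<And>r z. 0 < r \<Longrightarrow> r \<le> R \<Longrightarrow> z \<in> sphere 0 1 \<Longrightarrow>
        norm (fx (of_real r * z) + of_int \<sigma> * \<i> * fy (of_real r * z)) \<le> M'"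
      using bounded_on_disc[OF cont(2)[of \<sigma>]] by blast
    then have "norm (gradient_coeff \<sigma> m r) \<le> M'" if "0 < r" "r \<le> R" for m r
      unfolding gradient_coeff_def using that R
      by (intro norm_fourier_coeff_le continuous_on_circle_dilation[OF cont(2)]) auto
    then show ?thesis by blast
  qed
  then obtain M' where GM: "\<And>\<sigma> m r. 0 < r \<Longrightarrow> r \<le> R \<Longrightarrow> norm (gradient_coeff \<sigma> m r) \<le> M' \<sigma>" by metis
  \<comment> \<open>For \<open>m = 0\<close> either sign would do; the choice made is 1.\<close>
  have sg: "\<exists>\<sigma>. (\<sigma> = 1 \<or> \<sigma> = -1) \<and> m = \<sigma> * int (nat \<bar>m\<bar>)" for m :: int
    by (rule exI[of _ "if m \<ge> 0 then 1 else -1"]) auto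
  have bd: "norm (circle_coeff m r) \<le> 2 * M * (r / R) ^ nat \<bar>m\<bar>" if r: "0 < r" "r \<le> R" for m r
  proof -
    obtain \<sigma> where \<sigma>: "\<sigma> = 1 \<or> \<sigma> = -1" "m = \<sigma> * int (nat \<bar>m\<bar>)" using sg by blast
    have "norm (circle_coeff (\<sigma> * int (nat \<bar>m\<bar>)) r) \<le> 2 * M * (r / R) ^ nat \<bar>m\<bar>"
      by (rule radial_bound[OF R(1,3) circle_coeff_derivative[OF \<sigma>(1)] gradient_coeff_derivative[OF \<sigma>(1)] FM GM r])
    with \<sigma>(2) show ?thesis by simp
  qed
  have "\<exists>C K. (\<forall>r. 0 < r \<longrightarrow> r \<le> R \<longrightarrow> norm (circle_coeff m r - r ^ nat \<bar>m\<bar> *\<^sub>R C) \<le> K * r ^ (nat \<bar>m\<bar> + 2)) \<and>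
      (C = 0 \<longrightarrow> (\<forall>r. 0 < r \<longrightarrow> r \<le> R \<longrightarrow> circle_coeff m r = 0))" for m
  proof -
    obtain \<sigma> where \<sigma>: "\<sigma> = 1 \<or> \<sigma> = -1" "m = \<sigma> * int (nat \<bar>m\<bar>)" using sg by blast
    obtain C K where "\<And>s. 0 < s \<Longrightarrow> s \<le> R \<Longrightarrow>
        norm (circle_coeff (\<sigma> * int (nat \<bar>m\<bar>)) s - s ^ nat \<bar>m\<bar> *\<^sub>R C) \<le> K * s ^ (nat \<bar>m\<bar> + 2)"
      "C = 0 \<Longrightarrow> \<forall>s. 0 < s \<longrightarrow> s \<le> R \<longrightarrow> circle_coeff (\<sigma> * int (nat \<bar>m\<bar>)) s = 0"
      by (rule radial_limit[where n = "nat \<bar>m\<bar>", OF R(1,3) circle_coeff_derivative[OF \<sigma>(1)] gradient_coeff_derivative[OF \<sigma>(1)] FM GM]) blast+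
    then show ?thesis unfolding \<sigma>(2)[symmetric] by blast
  qed
  then obtain C K where "\<And>m r. 0 < r \<Longrightarrow> r \<le> R \<Longrightarrow> norm (circle_coeff m r - r ^ nat \<bar>m\<bar> *\<^sub>R C m) \<le> K m * r ^ (nat \<bar>m\<bar> + 2)"
    "\<And>m r. C m = 0 \<Longrightarrow> 0 < r \<Longrightarrow> r \<le> R \<Longrightarrow> circle_coeff m r = 0"
    by metis
  with bd show thesis by (rule that)
qed

lemma eq_0_if_coeffs_0:
  assumes F0: "\<And>m r. 0 < r \<Longrightarrow> r \<le> R \<Longrightarrow> circle_coeff m r = 0" and f0: "f 0 = 0" and z: "z \<in> ball 0 R"
  shows "f z = 0"
proof (cases "z = 0")
  case False
  let ?r = "norm z"
  have r: "0 < ?r" "?r \<le> R" "?r < \<rho>" using False z R by auto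
  have "f (of_real ?r * (z / of_real ?r)) = 0"
  proof (rule fourier_coeff_eq_0_imp[where g = "\<lambda>z. f (of_real ?r * z)"])
    show "continuous_on (sphere 0 1) (\<lambda>z. f (of_real ?r * z))"
      using r by (intro continuous_on_circle_dilation[OF C1_grad_continuous[OF f]]) auto
    show "fourier_coeff (\<lambda>z. f (of_real ?r * z)) m = 0" for m
      using F0[OF r(1,2)] by (simp add: circle_coeff_def)
  qed (use r in \<open>simp add: norm_divide\<close>)
  then show ?thesis using r by simp
qed (simp add: f0)

text \<open>If \<open>f\<close> vanishes near 0, the asymptotics give
  \<open>norm (C m) \<le> K m * r\<^sup>2\<close> for all small \<open>r\<close>, so every
  \<open>C m\<close> is 0 and every mode vanishes up to the radius \<open>R\<close>. The point is
  that \<open>R\<close> does not depend on \<open>\<delta>\<close>.\<close>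

lemma unique_continuation:
  assumes "\<delta> > 0" and zero: "\<And>z. z \<in> ball 0 \<delta> \<Longrightarrow> f z = 0" and z: "z \<in> ball 0 R"
  shows "f z = 0"
proof -
  obtain M C K where "\<And>m r. 0 < r \<Longrightarrow> r \<le> R \<Longrightarrow> norm (circle_coeff m r) \<le> 2 * M * (r / R) ^ nat \<bar>m\<bar>"
    and *: "\<And>m r. 0 < r \<Longrightarrow> r \<le> R \<Longrightarrow> norm (circle_coeff m r - r ^ nat \<bar>m\<bar> *\<^sub>R C m) \<le> K m * r ^ (nat \<bar>m\<bar> + 2)"
    and C0: "\<And>m r. C m = 0 \<Longrightarrow> 0 < r \<Longrightarrow> r \<le> R \<Longrightarrow> circle_coeff m r = 0"
    by (rule coeff_asymptotics) blast
  have "C m = 0" for m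
  proof -
    have F0: "circle_coeff m r = 0" if "0 < r" "r < \<delta>" for r
    proof -
      have "circle_coeff m r = fourier_coeff (\<lambda>z. 0) m"
        unfolding circle_coeff_def by (rule fourier_coeff_cong, rule zero) (use that in \<open>simp add: norm_mult\<close>)
      then show ?thesis by (simp add: fourier_coeff_def)
    qed
    have "((\<lambda>r::real. K m * r\<^sup>2) \<longlongrightarrow> K m * 0\<^sup>2) (at_right 0)"
      by (intro tendsto_intros)
    moreover have "\<forall>\<^sub>F r in at_right 0. norm (C m) \<le> K m * r\<^sup>2"
      unfolding eventually_at_right_field
    proof (intro exI[of _ "min \<delta> R"] conjI allI impI)
      fix r assume r: "0 < r" "r < min \<delta> R"
      then have "r ^ nat \<bar>m\<bar> * norm (C m) \<le> r ^ nat \<bar>m\<bar> * (K m * r\<^sup>2)"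
        using *[of r m] F0[of r] by (simp add: power_add mult_ac power2_eq_square)
      then show "norm (C m) \<le> K m * r\<^sup>2" using r by (simp only: mult_le_cancel_left_pos zero_less_power)
    qed (use assms R in auto)
    ultimately have "norm (C m) \<le> K m * 0\<^sup>2"
      by (intro tendsto_lowerbound) auto
    then show ?thesis by simp
  qed
  then show ?thesis
    using eq_0_if_coeffs_0[OF C0] zero[of 0] assms(1) z by simp
qed

text \<open>\<open>N\<close> is the least order at which a constant \<open>C (int n)\<close> or
  \<open>C (- int n)\<close> is nonzero. All lower modes vanish identically, the modes beyond
  \<open>N\<close> sum to O(r^(N+1)) by the geometric bound, and the two modes of order
  \<open>N\<close> differ from their leading terms by O(r^(N+2)).\<close>

lemma leading_term:
  assumes f0: "f 0 = 0" and nz: "z0 \<in> ball 0 R" "f z0 \<noteq> 0"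
  obtains N a b K where "N > 0" "a \<noteq> 0 \<or> b \<noteq> 0"
    "\<And>z. z \<in> ball 0 (R/2) \<Longrightarrow> norm (f z - (a * z ^ N + b * cnj z ^ N)) \<le> K * norm z ^ (N + 1)"
proof -
  obtain M C K where bd: "\<And>m r. 0 < r \<Longrightarrow> r \<le> R \<Longrightarrow> norm (circle_coeff m r) \<le> 2 * M * (r / R) ^ nat \<bar>m\<bar>"
    and as: "\<And>m r. 0 < r \<Longrightarrow> r \<le> R \<Longrightarrow> norm (circle_coeff m r - r ^ nat \<bar>m\<bar> *\<^sub>R C m) \<le> K m * r ^ (nat \<bar>m\<bar> + 2)"
    and C0: "\<And>m r. C m = 0 \<Longrightarrow> 0 < r \<Longrightarrow> r \<le> R \<Longrightarrow> circle_coeff m r = 0"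
    by (rule coeff_asymptotics) blast
  have cf: "continuous_on (ball 0 \<rho>) f" by (rule C1_grad_continuous[OF f])
  have "\<exists>m. C m \<noteq> 0" using eq_0_if_coeffs_0[OF C0 f0 nz(1)] nz(2) by blast
  then have ex: "\<exists>n::nat. C (int n) \<noteq> 0 \<or> C (- int n) \<noteq> 0"
    by (metis int_cases2)
  define N where "N = (LEAST n::nat. C (int n) \<noteq> 0 \<or> C (- int n) \<noteq> 0)"
  have N: "C (int N) \<noteq> 0 \<or> C (- int N) \<noteq> 0"
    unfolding N_def by (rule LeastI_ex[OF ex])
  have below: "C (int n) = 0 \<and> C (- int n) = 0" if "n < N" for n
    using not_less_Least[OF that[unfolded N_def]] by blast
  \<comment> \<open>The zeroth coefficient is the mean of \<open>f\<close> over a circle and tends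
    to \<open>f 0 = 0\<close>. This gives \<open>N > 0\<close>, without which the phases would carry
    no information about the angle.\<close>
  have "C 0 = 0"
  proof -
    have "isCont f 0" using cf R by (auto simp: continuous_on_eq_continuous_at)
    then have fl: "(f \<longlongrightarrow> 0) (at 0)" using f0 by (simp add: isCont_def)
    have F0: "(circle_coeff 0 \<longlongrightarrow> 0) (at_right 0)"
    proof (rule tendstoI)
      fix e :: real assume e: "e > 0"
      then obtain d where d: "d > 0" "\<And>z. z \<noteq> 0 \<Longrightarrow> norm z < d \<Longrightarrow> norm (f z) < e / 2"
        using tendstoD[OF fl, of "e/2"] by (auto simp: eventually_at dist_norm)
      show "\<forall>\<^sub>F r in at_right 0. dist (circle_coeff 0 r) 0 < e"
        unfolding eventually_at_right_field
      proof (intro exI[of _ "min d R"] conjI allI impI)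
        fix r assume r: "0 < r" "r < min d R"
        have "norm (circle_coeff 0 r) \<le> e / 2"
          unfolding circle_coeff_def
        proof (rule norm_fourier_coeff_le)
          show "continuous_on (sphere 0 1) (\<lambda>z. f (of_real r * z))"
            using r R by (intro continuous_on_circle_dilation[OF cf]) auto
          show "norm (f (of_real r * z)) \<le> e / 2" if "z \<in> sphere 0 1" for z
            using d(2)[of "of_real r * z"] r that by (force simp: norm_mult)
        qed
        then show "dist (circle_coeff 0 r) 0 < e" using e by simp
      qed (use d R in auto)
    qed
    have "((\<lambda>r. circle_coeff 0 r - C 0) \<longlongrightarrow> 0) (at_right 0)"
    proof (rule Lim_null_comparison)
      show "\<forall>\<^sub>F r in at_right 0. norm (circle_coeff 0 r - C 0) \<le> K 0 * r\<^sup>2"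
        unfolding eventually_at_right_field
        by (intro exI[of _ R]) (use as[of _ 0] R in \<open>auto simp: numeral_2_eq_2\<close>)
      have "((\<lambda>r::real. K 0 * r\<^sup>2) \<longlongrightarrow> K 0 * 0\<^sup>2) (at_right 0)"
        by (intro tendsto_intros)
      then show "((\<lambda>r::real. K 0 * r\<^sup>2) \<longlongrightarrow> 0) (at_right 0)" by simp
    qed
    then have "(circle_coeff 0 \<longlongrightarrow> C 0) (at_right 0)" by (simp add: LIM_zero_iff)
    then show ?thesis using F0 tendsto_unique trivial_limit_at_right_real by blast
  qed
  then have N0: "N > 0" using N by (cases N) auto
  \<comment> \<open>The first summand comes from the remainder bound \<open>4 * A * q ^ K\<close>
    with \<open>A = 2 * M\<close>, \<open>q = r / R\<close> and \<open>K = N + 1\<close>; its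
    condition \<open>q \<le> 1/2\<close> is the reason for the disc of radius \<open>R/2\<close>.
    The other two come from trading one factor \<open>r\<close> of \<open>r ^ (N + 2)\<close> for
    \<open>R\<close>.\<close>
  define L where "L = 8 * M / R ^ (N+1) + \<bar>K (int N)\<bar> * R + \<bar>K (- int N)\<bar> * R"
  show thesis
  proof (rule that[OF N0 N])
    fix w :: complex assume w: "w \<in> ball 0 (R/2)"
    show "norm (f w - (C (int N) * w ^ N + C (- int N) * cnj w ^ N)) \<le> L * norm w ^ (N + 1)"
    proof (cases "w = 0")
      case True
      then show ?thesis using f0 N0 by (simp add: power_0_left)
    next
      case False
      define r where "r = norm w"
      define z where "z = w / of_real r"
      have r: "0 < r" "r \<le> R" "r < R/2" using False w R by (auto simp: r_def)
      have w_eq: "w = of_real r * z" using r by (simp add: z_def)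
      have z: "norm z = 1" using r by (simp add: z_def norm_divide r_def)
      have "cnj z = inverse z" using z by (metis complex_div_cnj div_by_1 inverse_eq_divide mult_1 of_real_1 power_one)
      then have zp: "z powi (- int N) = cnj z ^ N" "z powi int N = z ^ N"
        by (simp_all add: power_int_minus power_inverse)
      have "norm (f (of_real r * z) - (\<Sum>n<N+1. \<Sum>m\<in>{int n, - int n}. circle_coeff m r * z powi m)) \<le> 4 * (2 * M) * (r / R) ^ (N+1)"
        unfolding circle_coeff_def
      proof (rule fourier_remainder_bound)
        show "continuous_on (sphere 0 1) (\<lambda>z. f (of_real r * z))"
          using r R by (intro continuous_on_circle_dilation[OF cf]) auto
        show "norm (fourier_coeff (\<lambda>z. f (of_real r * z)) m) \<le> 2 * M * (r / R) ^ nat \<bar>m\<bar>" for m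
          using bd[OF r(1,2)] by (simp add: circle_coeff_def)
      qed (use r R z in auto)
      moreover have "(\<Sum>n<N+1. \<Sum>m\<in>{int n, - int n}. circle_coeff m r * z powi m)
          = circle_coeff (int N) r * z ^ N + circle_coeff (- int N) r * cnj z ^ N"
      proof -
        have "(\<Sum>n<N. \<Sum>m\<in>{int n, - int n}. circle_coeff m r * z powi m) = 0"
          by (intro sum.neutral ballI) (use below C0[OF _ r(1,2)] in auto)
        then show ?thesis using N0 zp by simp
      qed
      ultimately have m: "norm (f w - (circle_coeff (int N) r * z ^ N + circle_coeff (- int N) r * cnj z ^ N)) \<le> 8 * M * (r / R) ^ (N+1)"
        by (simp add: w_eq)
      have e: "norm (circle_coeff m r * y - C m * of_real r ^ N * y) \<le> \<bar>K m\<bar> * R * r ^ (N+1)"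
        if "nat \<bar>m\<bar> = N" "norm y = 1" for m y
      proof -
        have "circle_coeff m r * y - C m * of_real r ^ N * y = (circle_coeff m r - r ^ nat \<bar>m\<bar> *\<^sub>R C m) * y"
          using that by (simp add: scaleR_conv_of_real algebra_simps)
        then have "norm (circle_coeff m r * y - C m * of_real r ^ N * y) \<le> K m * r ^ (N + 2)"
          using as[OF r(1,2), of m] that by (simp add: norm_mult)
        also have "\<dots> \<le> \<bar>K m\<bar> * r ^ (N + 2)" using r by (intro mult_right_mono) auto
        also have "\<dots> = \<bar>K m\<bar> * r * r ^ (N + 1)" by simp
        also have "\<dots> \<le> \<bar>K m\<bar> * R * r ^ (N+1)"
          using r by (intro mult_right_mono mult_left_mono) auto
        finally show ?thesis .
      qed
      have "f w - (C (int N) * w ^ N + C (- int N) * cnj w ^ N)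
         = (f w - (circle_coeff (int N) r * z ^ N + circle_coeff (- int N) r * cnj z ^ N))
          + (circle_coeff (int N) r * z ^ N - C (int N) * of_real r ^ N * z ^ N)
          + (circle_coeff (- int N) r * cnj z ^ N - C (- int N) * of_real r ^ N * cnj z ^ N)"
        by (simp add: w_eq power_mult_distrib algebra_simps)
      also have "norm \<dots> \<le> 8 * M * (r / R) ^ (N+1) + \<bar>K (int N)\<bar> * R * r ^ (N+1) + \<bar>K (- int N)\<bar> * R * r ^ (N+1)"
        by (intro norm_triangle_mono m e) (use z in \<open>auto simp: norm_power\<close>)
      also have "\<dots> = L * r ^ (N+1)"
        by (simp add: L_def power_divide algebra_simps)
      finally show ?thesis by (simp add: r_def)
    qed
  qed
qed

end

section \<open>Solutions in the plane\<close>

text \<open>Differentiating \<open>f x y - f x b\<close>, the integral of \<open>fy x\<close> over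
  \<open>{b..y}\<close>, under the integral sign expresses \<open>fx a y - fx a b\<close> as the
  integral of \<open>fyx a\<close>; differentiating in \<open>y\<close> at \<open>b\<close> gives
  the claim. The rectangle extends only upwards from \<open>b\<close>, since a one-sided derivative
  at the end point of an interval is already unique.\<close>

lemma mixed_partials_commute:
  fixes f fx fy fxy fyx :: "real \<Rightarrow> real \<Rightarrow> 'c::banach"
  assumes e: "e > 0"
    and fx: "\<And>x y. x \<in> {a-e..a+e} \<Longrightarrow> y \<in> {b..b+e} \<Longrightarrow> ((\<lambda>x. f x y) has_vector_derivative fx x y) (at x)"
    and fy: "\<And>x y. x \<in> {a-e..a+e} \<Longrightarrow> y \<in> {b..b+e} \<Longrightarrow> (f x has_vector_derivative fy x y) (at y)"
    and fyx: "\<And>x y. x \<in> {a-e..a+e} \<Longrightarrow> y \<in> {b..b+e} \<Longrightarrow> ((\<lambda>x. fy x y) has_vector_derivative fyx x y) (at x)"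
    and fxy: "(fx a has_vector_derivative fxy a b) (at b)"
    and cont: "continuous_on ({a-e..a+e} \<times> {b..b+e}) (\<lambda>(x, y). fyx x y)"
  shows "fxy a b = fyx a b"
proof -
  have eq: "fx a b + integral {b..y} (fyx a) = fx a y" if y: "y \<in> {b..b+e}" for y
  proof -
    have int: "(fy x has_integral (f x y - f x b)) {b..y}" if "x \<in> {a-e..a+e}" for x
      using that y fy[OF that]
      by (intro fundamental_theorem_of_calculus) (auto intro: has_vector_derivative_at_within)
    have "((\<lambda>x. integral (cbox b y) (fy x)) has_vector_derivative integral (cbox b y) (fyx a))
        (at a within {a-e..a+e})"
    proof (rule leibniz_rule_vector_derivative)
      show "continuous_on ({a-e..a+e} \<times> cbox b y) (\<lambda>(x, t). fyx x t)"
        by (rule continuous_on_subset[OF cont]) (use y in auto)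
      show "((\<lambda>x. fy x t) has_vector_derivative fyx x t) (at x within {a-e..a+e})"
        if "x \<in> {a-e..a+e}" "t \<in> cbox b y" for x t
        by (rule has_vector_derivative_at_within, rule fyx) (use that y in auto)
      show "fy x integrable_on cbox b y" if "x \<in> {a-e..a+e}" for x
        using int[OF that] by (auto simp: integrable_on_def)
    qed (use e in auto)
    moreover have "((\<lambda>x. f x y - f x b) has_vector_derivative fx a y - fx a b) (at a within {a-e..a+e})"
      by (rule has_vector_derivative_at_within, rule has_vector_derivative_diff; rule fx) (use y e in auto)
    then have "((\<lambda>x. integral (cbox b y) (fy x)) has_vector_derivative fx a y - fx a b) (at a within {a-e..a+e})"
      by (rule has_vector_derivative_transform[rotated 2]) (use e in \<open>simp_all add: integral_unique[OF int]\<close>)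
    moreover have "at a within {a-e..a+e} \<noteq> bot"
      using e by (simp add: trivial_limit_within islimpt_Icc)
    ultimately have "integral (cbox b y) (fyx a) = fx a y - fx a b"
      using vector_derivative_unique_within by blast
    then show ?thesis by simp
  qed
  have "continuous_on {b..b+e} (\<lambda>y. (\<lambda>(x, y). fyx x y) (a, y))"
    by (rule continuous_on_compose2[OF cont]) (use e in \<open>auto intro!: continuous_intros\<close>)
  then have "continuous_on {b..b+e} (fyx a)" by simp
  then have "((\<lambda>y. integral {b..y} (fyx a)) has_vector_derivative fyx a b) (at b within {b..b+e})"
    using e by (intro integral_has_vector_derivative) auto
  then have "((\<lambda>y. fx a b + integral {b..y} (fyx a)) has_vector_derivative fyx a b) (at b within {b..b+e})"
    by (auto intro!: derivative_eq_intros)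
  then have "(fx a has_vector_derivative fyx a b) (at b within {b..b+e})"
    by (rule has_vector_derivative_transform[rotated 2]) (use e in \<open>simp_all add: eq\<close>)
  moreover have "(fx a has_vector_derivative fxy a b) (at b within {b..b+e})"
    using fxy by (rule has_vector_derivative_at_within)
  ultimately show ?thesis
    using vector_derivative_unique_within[of b "{b..b+e}"] e
    by (simp add: islimpt_Icc trivial_limit_within)
qed

section \<open>Complex coordinates centred at a point of the plane\<close>

text \<open>Written with the basis vectors, so that the chain rule produces derivatives along
  \<open>axis 1 1\<close> and \<open>axis 2 1\<close> directly.\<close>

definition plane_chart :: "real^2 \<Rightarrow> complex \<Rightarrow> real^2"
  where "plane_chart p z = p + (Re z *\<^sub>R axis 1 1 + Im z *\<^sub>R axis 2 1)"

definition plane_coord :: "real^2 \<Rightarrow> complex"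
  where "plane_coord x = Complex (x $ 1) (x $ 2)"

lemma plane_chart_nth [simp]: "plane_chart p z $ 1 = p $ 1 + Re z" "plane_chart p z $ 2 = p $ 2 + Im z"
  by (simp_all add: plane_chart_def axis_def)

lemma plane_coord_inverse [simp]: "plane_chart p (plane_coord (x - p)) = x"
  by (simp add: vec_eq_iff forall_2 plane_coord_def)

lemma norm_plane_coord [simp]: "norm (plane_coord x) = norm x"
  by (simp add: plane_coord_def cmod_def norm_vec_def L2_set_def sum_2)

lemma linear_plane_coord: "linear plane_coord"
  by (rule linearI) (simp_all add: plane_coord_def complex_eq_iff)

lemma plane_coord_unit_dir [simp]: "plane_coord (unit_dir \<theta>) = cis \<theta>"
  by (simp add: plane_coord_def unit_dir_def complex_eq_iff)

lemma plane_coord_chart [simp]: "plane_coord (plane_chart p z - p) = z"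
  by (simp add: plane_coord_def complex_eq_iff)

lemma dist_plane_chart [simp]: "dist p (plane_chart p z) = norm z"
  using norm_plane_coord[of "plane_chart p z - p"] by (simp only: plane_coord_chart dist_norm norm_minus_commute)

lemma sum_Basis_2: "(\<Sum>b\<in>(Basis :: (real^2) set). g b) = g (axis 1 1) + g (axis 2 1)"
proof -
  have "(Basis :: (real^2) set) = {axis 1 1, axis 2 1}"
    by (auto simp: Basis_vec_def UNIV_2)
  moreover have "sum g {axis 1 1, axis 2 1 :: real^2} = g (axis 1 1) + sum g {axis 2 1}"
    by (rule sum.insert) (simp_all add: axis_eq_axis)
  ultimately show ?thesis by simp
qed

lemma axis_in_Basis_2: "axis i 1 \<in> (Basis :: (real^2) set)"
  by (auto simp: Basis_vec_def)

lemma C1_on_imp_C1_grad: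
  fixes w :: "real^2 \<Rightarrow> complex"
  assumes w: "C1_on U w" and U: "ball p \<rho> \<subseteq> U"
  shows "C1_grad (ball 0 \<rho>) (\<lambda>z. w (plane_chart p z))
    (\<lambda>z. dir_deriv (axis 1 1) w (plane_chart p z)) (\<lambda>z. dir_deriv (axis 2 1) w (plane_chart p z))"
  unfolding C1_grad_def
proof (intro conjI ballI)
  have chart: "plane_chart p z \<in> U" if "z \<in> ball 0 \<rho>" for z
    using that U by (auto simp: subset_iff)
  have cont: "continuous_on (ball 0 \<rho>) (\<lambda>z. dir_deriv (axis i 1) w (plane_chart p z))" for i
  proof (rule continuous_on_compose2[of U])
    show "continuous_on U (dir_deriv (axis i 1) w)"
      using w axis_in_Basis_2 unfolding C1_on_def by blast
    show "continuous_on (ball 0 \<rho>) (plane_chart p)"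
      unfolding plane_chart_def by (intro continuous_intros)
  qed (use chart in auto)
  from cont show "continuous_on (ball 0 \<rho>) (\<lambda>z. dir_deriv (axis 1 1) w (plane_chart p z))" .
  from cont show "continuous_on (ball 0 \<rho>) (\<lambda>z. dir_deriv (axis 2 1) w (plane_chart p z))" .
  fix z :: complex assume "z \<in> ball 0 \<rho>"
  then have "w differentiable at (plane_chart p z)"
    using w chart unfolding C1_on_def by blast
  then have w': "(w has_derivative frechet_derivative w (at (plane_chart p z))) (at (plane_chart p z))"
    by (simp add: frechet_derivative_works)
  have "(plane_chart p has_derivative (\<lambda>h. Re h *\<^sub>R axis 1 1 + Im h *\<^sub>R axis 2 1)) (at z)"
    unfolding plane_chart_def[abs_def] by (auto intro!: derivative_eq_intros)
  from has_derivative_compose[OF this w']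
  have "((\<lambda>z. w (plane_chart p z)) has_derivative
      (\<lambda>h. frechet_derivative w (at (plane_chart p z)) (Re h *\<^sub>R axis 1 1 + Im h *\<^sub>R axis 2 1))) (at z)" .
  moreover have "linear (frechet_derivative w (at (plane_chart p z)))"
    using w' has_derivative_linear by blast
  ultimately show "((\<lambda>z. w (plane_chart p z)) has_derivative
      (\<lambda>h. of_real (Re h) * dir_deriv (axis 1 1) w (plane_chart p z)
         + of_real (Im h) * dir_deriv (axis 2 1) w (plane_chart p z))) (at z)"
    by (simp add: linear_add linear_scale dir_deriv_def scaleR_conv_of_real[where 'a = complex])
qed

lemma C1_grad_partials:
  assumes "C1_grad S f fx fy" "Complex x y \<in> S"
  shows "((\<lambda>x. f (Complex x y)) has_vector_derivative fx (Complex x y)) (at x)"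
    and "((\<lambda>y. f (Complex x y)) has_vector_derivative fy (Complex x y)) (at y)"
proof -
  have f: "(f has_derivative (\<lambda>h. of_real (Re h) * fx (Complex x y) + of_real (Im h) * fy (Complex x y))) (at (Complex x y))"
    using assms unfolding C1_grad_def by blast
  have "((\<lambda>x. Complex x y) has_derivative (\<lambda>h. of_real h)) (at x)"
    unfolding Complex_eq by (auto intro!: derivative_eq_intros)
  from has_derivative_compose[OF this f]
  show "((\<lambda>x. f (Complex x y)) has_vector_derivative fx (Complex x y)) (at x)"
    by (simp add: has_vector_derivative_def scaleR_conv_of_real)
  have "((\<lambda>y. Complex x y) has_derivative (\<lambda>h. \<i> * of_real h)) (at y)"
    unfolding Complex_eq by (auto intro!: derivative_eq_intros)
  from has_derivative_compose[OF this f]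
  show "((\<lambda>y. f (Complex x y)) has_vector_derivative fy (Complex x y)) (at y)"
    by (simp add: has_vector_derivative_def scaleR_conv_of_real)
qed

lemma C1_grad_mixed_partials_commute:
  assumes f: "C1_grad (ball 0 \<rho>) f fx fy" and fx: "C1_grad (ball 0 \<rho>) fx fxx fxy"
    and fy: "C1_grad (ball 0 \<rho>) fy fyx fyy" and z: "z \<in> ball 0 \<rho>"
  shows "fxy z = fyx z"
proof -
  \<comment> \<open>Points of the rectangle lie within \<open>2 * e\<close> of \<open>z\<close>, so
    a third of the distance to the circle leaves room to spare.\<close>
  define e where "e = (\<rho> - norm z) / 3"
  have e: "e > 0" using z by (simp add: e_def)
  have S: "Complex x y \<in> ball 0 \<rho>" if "x \<in> {Re z - e..Re z + e}" "y \<in> {Im z..Im z + e}" for x y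
  proof -
    have "norm (Complex x y - z) \<le> \<bar>x - Re z\<bar> + \<bar>y - Im z\<bar>"
      using cmod_le[of "Complex x y - z"] by simp
    also have "\<dots> \<le> e + e" using that by (intro add_mono) auto
    finally have "norm (Complex x y) \<le> norm z + 2 * e"
      using norm_triangle_sub[of "Complex x y" z] by simp
    also have "\<dots> < \<rho>" using z by (simp add: e_def field_simps)
    finally show ?thesis by simp
  qed
  have "(\<lambda>x y. fxy (Complex x y)) (Re z) (Im z) = (\<lambda>x y. fyx (Complex x y)) (Re z) (Im z)"
  proof (rule mixed_partials_commute[OF e, where f = "\<lambda>x y. f (Complex x y)"
        and fx = "\<lambda>x y. fx (Complex x y)" and fy = "\<lambda>x y. fy (Complex x y)"])
    show "continuous_on ({Re z - e..Re z + e} \<times> {Im z..Im z + e}) (\<lambda>(x, y). fyx (Complex x y))"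
      unfolding split_beta
    proof (rule continuous_on_compose2[of "ball 0 \<rho>" fyx])
      show "continuous_on (ball 0 \<rho>) fyx" using fy by (simp add: C1_grad_def)
      show "continuous_on ({Re z - e..Re z + e} \<times> {Im z..Im z + e}) (\<lambda>p. Complex (fst p) (snd p))"
        unfolding Complex_eq by (intro continuous_intros)
    qed (use S in auto)
    show "((\<lambda>y. fx (Complex (Re z) y)) has_vector_derivative fxy (Complex (Re z) (Im z))) (at (Im z))"
      by (rule C1_grad_partials[OF fx]) (use z in simp)
  qed (rule C1_grad_partials[OF f] C1_grad_partials[OF fy], erule (1) S)+
  then show ?thesis by simp
qed

lemma helmholtz_on_imp_disc:
  fixes w :: "real^2 \<Rightarrow> complex"
  assumes w: "helmholtz_on k U w" and U: "ball p \<rho> \<subseteq> U" and R: "0 < R" "R < \<rho>" "k\<^sup>2 * R\<^sup>2 \<le> 1/2"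
  shows "helmholtz_disc (\<lambda>z. w (plane_chart p z))
    (\<lambda>z. dir_deriv (axis 1 1) w (plane_chart p z)) (\<lambda>z. dir_deriv (axis 2 1) w (plane_chart p z))
    (\<lambda>z. dir_deriv (axis 1 1) (dir_deriv (axis 1 1) w) (plane_chart p z))
    (\<lambda>z. dir_deriv (axis 2 1) (dir_deriv (axis 1 1) w) (plane_chart p z))
    (\<lambda>z. dir_deriv (axis 1 1) (dir_deriv (axis 2 1) w) (plane_chart p z))
    (\<lambda>z. dir_deriv (axis 2 1) (dir_deriv (axis 2 1) w) (plane_chart p z)) k \<rho> R"
proof -
  have C1: "C1_on U w" "C1_on U (dir_deriv (axis i 1) w)" for i
    using w axis_in_Basis_2 unfolding helmholtz_on_def C2_on_def by blast+
  note C = C1_on_imp_C1_grad[OF C1(1) U] C1_on_imp_C1_grad[OF C1(2) U] C1_on_imp_C1_grad[OF C1(2) U]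
  show ?thesis
  proof (unfold_locales, rule C, rule C, rule C)
    fix z :: complex assume z: "z \<in> ball 0 \<rho>"
    then have "plane_chart p z \<in> U" using U by (auto simp: subset_iff)
    then have "laplacian w (plane_chart p z) + k\<^sup>2 *\<^sub>R w (plane_chart p z) = 0"
      using w unfolding helmholtz_on_def by blast
    then show "dir_deriv (axis 1 1) (dir_deriv (axis 1 1) w) (plane_chart p z)
        + dir_deriv (axis 2 1) (dir_deriv (axis 2 1) w) (plane_chart p z)
        + of_real (k\<^sup>2) * w (plane_chart p z) = 0"
      by (simp only: laplacian_def sum_Basis_2 scaleR_conv_of_real)
    show "dir_deriv (axis 2 1) (dir_deriv (axis 1 1) w) (plane_chart p z)
        = dir_deriv (axis 1 1) (dir_deriv (axis 2 1) w) (plane_chart p z)"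
      by (rule C1_grad_mixed_partials_commute[OF C z])
  qed (use R in auto)
qed

lemma obtain_disc_radius:
  fixes k :: real
  assumes "0 < \<rho>"
  obtains R where "0 < R" "R < \<rho>" "k\<^sup>2 * R\<^sup>2 \<le> 1/2"
proof -
  \<comment> \<open>\<open>d\<close> is positive even for \<open>k = 0\<close>, and
    \<open>R \<le> 1 / d\<close> gives \<open>\<bar>k\<bar> * R \<le> 1/2\<close>.\<close>
  define d where "d = 2 * (\<bar>k\<bar> + 1)"
  define R where "R = min (\<rho> / 2) (1 / d)"
  have d: "d > 0" by (simp add: d_def add_nonneg_pos)
  have R: "0 < R" "R < \<rho>" using assms d by (auto simp: R_def)
  have "\<bar>k\<bar> * R \<le> \<bar>k\<bar> * (1 / d)" by (intro mult_left_mono) (auto simp: R_def)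
  also have "\<dots> \<le> 1/2" using d by (simp add: pos_divide_le_eq) (simp add: d_def)
  finally have "(\<bar>k\<bar> * R)\<^sup>2 \<le> (1/2)\<^sup>2" using R by (intro power_mono) auto
  also have "(\<bar>k\<bar> * R)\<^sup>2 = k\<^sup>2 * R\<^sup>2" by (simp add: power_mult_distrib)
  also have "(1/2)\<^sup>2 \<le> (1/2 :: real)" by (simp add: power2_eq_square)
  finally show thesis using R that by blast
qed

lemma helmholtz_unique_continuation_ball:
  fixes w :: "real^2 \<Rightarrow> complex"
  assumes "helmholtz_on k U w" "ball p \<rho> \<subseteq> U" "0 < R" "R < \<rho>" "k\<^sup>2 * R\<^sup>2 \<le> 1/2"
    and "\<delta> > 0" "\<And>x. x \<in> ball p \<delta> \<Longrightarrow> w x = 0" and "x \<in> ball p R"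
  shows "w x = 0"
proof -
  interpret helmholtz_disc "\<lambda>z. w (plane_chart p z)"
    "\<lambda>z. dir_deriv (axis 1 1) w (plane_chart p z)" "\<lambda>z. dir_deriv (axis 2 1) w (plane_chart p z)"
    "\<lambda>z. dir_deriv (axis 1 1) (dir_deriv (axis 1 1) w) (plane_chart p z)"
    "\<lambda>z. dir_deriv (axis 2 1) (dir_deriv (axis 1 1) w) (plane_chart p z)"
    "\<lambda>z. dir_deriv (axis 1 1) (dir_deriv (axis 2 1) w) (plane_chart p z)"
    "\<lambda>z. dir_deriv (axis 2 1) (dir_deriv (axis 2 1) w) (plane_chart p z)" k \<rho> R
    by (rule helmholtz_on_imp_disc[OF assms(1-5)])
  have "w (plane_chart p (plane_coord (x - p))) = 0"
  proof (rule unique_continuation[OF assms(6)])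
    show "w (plane_chart p z) = 0" if "z \<in> ball 0 \<delta>" for z
      by (rule assms(7)) (use that in simp)
    show "plane_coord (x - p) \<in> ball 0 R"
      using assms(8) by (simp add: dist_norm norm_minus_commute)
  qed
  then show ?thesis by simp
qed

text \<open>The set of points with a neighbourhood on which \<open>w\<close> vanishes is open by
  construction. Its complement in \<open>\<Omega>\<close> is open because the radius of the local
  result does not depend on how small that neighbourhood is.\<close>

lemma helmholtz_unique_continuation:
  fixes w :: "real^2 \<Rightarrow> complex"
  assumes w: "helmholtz_on k \<Omega> w" and \<Omega>: "open \<Omega>" "connected \<Omega>"
    and x0: "x0 \<in> \<Omega>" "\<delta> > 0" "\<And>x. x \<in> ball x0 \<delta> \<Longrightarrow> w x = 0" and x: "x \<in> \<Omega>"
  shows "w x = 0"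
proof -
  define A where "A = {x \<in> \<Omega>. \<exists>\<delta>>0. \<forall>y\<in>ball x \<delta>. w y = 0}"
  have opA: "open A"
    unfolding open_contains_ball
  proof
    fix x assume "x \<in> A"
    then obtain \<delta> where \<delta>: "x \<in> \<Omega>" "\<delta> > 0" "\<forall>y\<in>ball x \<delta>. w y = 0" unfolding A_def by blast
    obtain \<epsilon> where \<epsilon>: "\<epsilon> > 0" "ball x \<epsilon> \<subseteq> \<Omega>" using \<Omega>(1) \<delta>(1) by (meson open_contains_ball)
    have "ball x (min \<delta> \<epsilon>) \<subseteq> A"
    proof
      fix y assume y: "y \<in> ball x (min \<delta> \<epsilon>)"
      then have "y \<in> ball x \<delta>" by simp
      then obtain \<eta> where "\<eta> > 0" "ball y \<eta> \<subseteq> ball x \<delta>" by (meson open_ball open_contains_ball)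
      then show "y \<in> A" using y \<delta>(3) \<epsilon>(2) unfolding A_def by (auto simp: subset_iff)
    qed
    then show "\<exists>e>0. ball x e \<subseteq> A" using \<delta>(2) \<epsilon>(1) by (intro exI[of _ "min \<delta> \<epsilon>"]) auto
  qed
  have opB: "open (\<Omega> - A)"
    unfolding open_contains_ball
  proof
    fix x assume x: "x \<in> \<Omega> - A"
    obtain \<rho> where \<rho>: "\<rho> > 0" "ball x \<rho> \<subseteq> \<Omega>" using \<Omega>(1) x by (meson DiffD1 open_contains_ball)
    \<comment> \<open>Halving \<open>\<rho>\<close> lets one \<open>R\<close> serve every centre
      \<open>a\<close> in \<open>ball x R\<close>: its disc of radius \<open>\<rho>/2\<close> stays
      in \<open>\<Omega>\<close>, and \<open>ball a R\<close> reaches back to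
      \<open>x\<close>.\<close>
    obtain R where R: "0 < R" "R < \<rho>/2" "k\<^sup>2 * R\<^sup>2 \<le> 1/2"
      using obtain_disc_radius[of "\<rho>/2" k] \<rho> by auto
    have "a \<notin> A" if a: "a \<in> ball x R" for a
    proof
      assume "a \<in> A"
      then obtain \<delta> where \<delta>: "\<delta> > 0" "\<And>y. y \<in> ball a \<delta> \<Longrightarrow> w y = 0" unfolding A_def by blast
      have "ball a (\<rho>/2) \<subseteq> ball x \<rho>"
      proof
        fix y assume "y \<in> ball a (\<rho>/2)"
        then show "y \<in> ball x \<rho>" using a R dist_triangle[of x y a] by simp
      qed
      then have ba: "ball a (\<rho>/2) \<subseteq> \<Omega>" using \<rho> by blast
      have z: "w y = 0" if "y \<in> ball a R" for y
        by (rule helmholtz_unique_continuation_ball[OF w ba R \<delta> that])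
      have "x \<in> ball a R" using a by (simp add: dist_commute)
      then obtain \<eta> where "\<eta> > 0" "ball x \<eta> \<subseteq> ball a R" by (meson open_ball open_contains_ball)
      then have "x \<in> A" using x z unfolding A_def by blast
      then show False using x by blast
    qed
    moreover have "ball x R \<subseteq> \<Omega>" using \<rho> R by (auto simp: subset_iff)
    ultimately show "\<exists>e>0. ball x e \<subseteq> \<Omega> - A" using R(1) by blast
  qed
  have "x0 \<in> A" using x0 unfolding A_def by blast
  then have "\<Omega> - A = {}"
    using connectedD[OF \<Omega>(2) opA opB] x0(1) by blast
  then have "x \<in> A" using x by blast
  then show ?thesis unfolding A_def by fastforce
qed

lemma helmholtz_leading_term:
  fixes w :: "real^2 \<Rightarrow> complex"
  assumes "helmholtz_on k U w" "ball p \<rho> \<subseteq> U" "0 < R" "R < \<rho>" "k\<^sup>2 * R\<^sup>2 \<le> 1/2"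
    and "w p = 0" and "x0 \<in> ball p R" "w x0 \<noteq> 0"
  obtains N a b K where "N > 0" "a \<noteq> 0 \<or> b \<noteq> 0"
    "\<And>x. x \<in> ball p (R/2) \<Longrightarrow> norm (w x - (a * plane_coord (x - p) ^ N + b * cnj (plane_coord (x - p)) ^ N))
      \<le> K * norm (x - p) ^ (N + 1)"
proof -
  interpret helmholtz_disc "\<lambda>z. w (plane_chart p z)"
    "\<lambda>z. dir_deriv (axis 1 1) w (plane_chart p z)" "\<lambda>z. dir_deriv (axis 2 1) w (plane_chart p z)"
    "\<lambda>z. dir_deriv (axis 1 1) (dir_deriv (axis 1 1) w) (plane_chart p z)"
    "\<lambda>z. dir_deriv (axis 2 1) (dir_deriv (axis 1 1) w) (plane_chart p z)"
    "\<lambda>z. dir_deriv (axis 1 1) (dir_deriv (axis 2 1) w) (plane_chart p z)"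
    "\<lambda>z. dir_deriv (axis 2 1) (dir_deriv (axis 2 1) w) (plane_chart p z)" k \<rho> R
    by (rule helmholtz_on_imp_disc[OF assms(1-5)])
  have 0: "w (plane_chart p 0) = 0" using assms(6) by (simp add: plane_chart_def)
  have 1: "plane_coord (x0 - p) \<in> ball 0 R" using assms(7) by (simp add: dist_norm norm_minus_commute)
  have 2: "w (plane_chart p (plane_coord (x0 - p))) \<noteq> 0" using assms(8) by simp
  obtain N a b K where *: "N > 0" "a \<noteq> 0 \<or> b \<noteq> 0"
    "\<And>z. z \<in> ball 0 (R/2) \<Longrightarrow> norm (w (plane_chart p z) - (a * z ^ N + b * cnj z ^ N)) \<le> K * norm z ^ (N + 1)"
    by (rule leading_term[OF 0 1 2]) blast
  show thesis
  proof (rule that[OF *(1,2)])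
    fix x assume "x \<in> ball p (R/2)"
    then have "plane_coord (x - p) \<in> ball 0 (R/2)" by (simp add: dist_norm norm_minus_commute)
    from *(3)[OF this] show "norm (w x - (a * plane_coord (x - p) ^ N + b * cnj (plane_coord (x - p)) ^ N))
      \<le> K * norm (x - p) ^ (N + 1)" by simp
  qed
qed

section \<open>Corners\<close>

text \<open>The arc approaches its tangent ray without lying on it, so the direction is reached only
  in the limit: the coordinate divided by \<open>t\<close> tends to \<open>c * cis \<theta>\<close>.
  Divided by \<open>t ^ N\<close>, the leading term stays homogeneous while the error is O(t), and
  the speed \<open>c\<close> finally drops out as the factor \<open>c ^ N\<close>.\<close>

lemma leading_term_vanishes_along_arc:
  assumes arc: "regular_arc_from p \<theta> \<gamma>"
    and zero: "\<And>t. t \<in> {0..1} \<Longrightarrow> \<gamma> t \<in> ball p \<epsilon> \<Longrightarrow> w (\<gamma> t) = 0" and \<epsilon>: "\<epsilon> > 0"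
    and lead: "\<And>x. x \<in> ball p \<rho> \<Longrightarrow> norm (w x - (a * plane_coord (x - p) ^ N + b * cnj (plane_coord (x - p)) ^ N))
      \<le> K * norm (x - p) ^ (N + 1)" and \<rho>: "\<rho> > 0"
  shows "a * cis \<theta> ^ N + b * cnj (cis \<theta>) ^ N = 0"
proof -
  obtain \<gamma>' c where \<gamma>0: "\<gamma> 0 = p" and d: "(\<gamma> has_vector_derivative \<gamma>' 0) (at 0 within {0..1})"
    and c: "c > 0" "\<gamma>' 0 = c *\<^sub>R unit_dir \<theta>"
    using arc unfolding regular_arc_from_def pathstart_def by force
  have at0: "at 0 within {0..1} = at_right (0::real)" by (simp add: at_within_Icc_at_right)
  define q where "q = (\<lambda>t. plane_coord (\<gamma> t - p) / of_real t)"
  have "((\<lambda>t. (1 / norm (t - 0)) *\<^sub>R (\<gamma> t - (\<gamma> 0 + (t - 0) *\<^sub>R \<gamma>' 0))) \<longlongrightarrow> 0) (at_right 0)"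
    using d unfolding has_vector_derivative_def has_derivative_within at0 by blast
  then have "((\<lambda>t. norm ((1 / norm (t - 0)) *\<^sub>R (\<gamma> t - (\<gamma> 0 + (t - 0) *\<^sub>R \<gamma>' 0)))) \<longlongrightarrow> 0) (at_right 0)"
    by (rule tendsto_norm_zero)
  moreover have "\<forall>\<^sub>F t in at_right 0. norm (q t - of_real c * cis \<theta>)
      \<le> norm ((1 / norm (t - 0)) *\<^sub>R (\<gamma> t - (\<gamma> 0 + (t - 0) *\<^sub>R \<gamma>' 0)))"
    using eventually_at_right_less[of 0]
  proof eventually_elim
    case (elim t)
    have "q t - of_real c * cis \<theta> = plane_coord ((1/t) *\<^sub>R (\<gamma> t - (p + t *\<^sub>R \<gamma>' 0)))"
      using elim linear_plane_coord
      by (simp add: q_def c linear_diff linear_add linear_scale scaleR_conv_of_real[where 'a = complex] field_simps)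
    then show ?case using elim \<gamma>0 by (simp del: norm_scaleR)
  qed
  ultimately have "((\<lambda>t. q t - of_real c * cis \<theta>) \<longlongrightarrow> 0) (at_right 0)"
    by (rule Lim_null_comparison[rotated])
  then have q: "(q \<longlongrightarrow> of_real c * cis \<theta>) (at_right 0)" by (rule LIM_zero_cancel)
  have \<gamma>lim: "(\<gamma> \<longlongrightarrow> p) (at_right 0)"
    using has_vector_derivative_continuous[OF d] \<gamma>0 unfolding continuous_within at0 by simp
  have "\<forall>\<^sub>F t in at_right 0. norm (a * q t ^ N + b * cnj (q t) ^ N) \<le> K * norm (q t) ^ (N+1) * t"
  proof -
    have "\<forall>\<^sub>F t in at_right 0. dist (\<gamma> t) p < min \<epsilon> \<rho>"
      using \<epsilon> \<rho> by (intro tendstoD[OF \<gamma>lim]) auto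
    moreover have "\<forall>\<^sub>F t::real in at_right 0. t < 1"
      unfolding eventually_at_right_field by (rule exI[of _ 1]) auto
    ultimately show ?thesis using eventually_at_right_less[of 0]
    proof eventually_elim
      case (elim t)
      define z where "z = plane_coord (\<gamma> t - p)"
      have z: "z = of_real t * q t" using elim by (simp add: q_def z_def)
      have nz: "norm (\<gamma> t - p) = norm z" by (simp add: z_def)
      have "w (\<gamma> t) = 0" using elim by (intro zero) (auto simp: dist_commute)
      then have "norm (0 - (a * z ^ N + b * cnj z ^ N)) \<le> K * norm z ^ (N + 1)"
        using lead[of "\<gamma> t", folded z_def, unfolded nz] elim by (simp add: dist_commute)
      then have "norm (a * z ^ N + b * cnj z ^ N) \<le> K * norm z ^ (N + 1)"
        by (simp only: diff_0 norm_minus_cancel)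
      moreover have "a * z ^ N + b * cnj z ^ N = of_real (t ^ N) * (a * q t ^ N + b * cnj (q t) ^ N)"
        by (simp add: z power_mult_distrib algebra_simps)
      ultimately have "t ^ N * norm (a * q t ^ N + b * cnj (q t) ^ N) \<le> t ^ N * (K * norm (q t) ^ (N+1) * t)"
        using elim by (simp add: norm_mult norm_power z power_mult_distrib mult_ac)
      then show ?case using elim by (simp only: mult_le_cancel_left_pos zero_less_power)
    qed
  qed
  moreover have "((\<lambda>t. norm (a * q t ^ N + b * cnj (q t) ^ N)) \<longlongrightarrow>
      norm (a * (of_real c * cis \<theta>) ^ N + b * cnj (of_real c * cis \<theta>) ^ N)) (at_right 0)"
    by (intro tendsto_intros q)
  moreover have "((\<lambda>t. K * norm (q t) ^ (N+1) * t) \<longlongrightarrow> K * norm (of_real c * cis \<theta>) ^ (N+1) * 0) (at_right 0)"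
    by (intro tendsto_intros q)
  ultimately have "norm (a * (of_real c * cis \<theta>) ^ N + b * cnj (of_real c * cis \<theta>) ^ N) \<le> K * norm (of_real c * cis \<theta>) ^ (N+1) * 0"
    using tendsto_le[OF trivial_limit_at_right_real] by blast
  then have "a * (of_real c * cis \<theta>) ^ N + b * cnj (of_real c * cis \<theta>) ^ N = 0" by simp
  then have "of_real (c ^ N) * (a * cis \<theta> ^ N + b * cnj (cis \<theta>) ^ N) = 0"
    by (simp add: power_mult_distrib algebra_simps)
  then show ?thesis using c by simp
qed

text \<open>Multiplication by \<open>cis (N * \<phi>)\<close> turns each condition into
  \<open>a * cis (2 * N * \<phi>) = - b\<close>. Hence \<open>a = 0\<close> would force
  \<open>b = 0\<close>; so \<open>a\<close> can be cancelled, the unknown phase of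
  \<open>- b / a\<close> disappears, and \<open>cis (2 * N * \<alpha>) = 1\<close> remains.\<close>

lemma angle_rational_if_leading_terms_vanish:
  assumes N: "N > 0" and ab: "a \<noteq> 0 \<or> b \<noteq> 0"
    and 1: "a * cis \<theta> ^ N + b * cnj (cis \<theta>) ^ N = 0"
    and 2: "a * cis (\<theta> + \<alpha>) ^ N + b * cnj (cis (\<theta> + \<alpha>)) ^ N = 0"
  shows "\<exists>r\<in>\<rat>. \<alpha> = r * pi"
proof -
  have e: "a * cis (2 * real N * \<phi>) = - b" if "a * cis \<phi> ^ N + b * cnj (cis \<phi>) ^ N = 0" for \<phi> :: real
  proof -
    have "cis (real N * \<phi>) * (a * cis (real N * \<phi>) + b * cis (- (real N * \<phi>))) = 0"
      using that by (simp add: cis_cnj Complex.DeMoivre)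
    moreover have "cis (real N * \<phi>) * (a * cis (real N * \<phi>) + b * cis (- (real N * \<phi>))) = a * (cis (real N * \<phi>) * cis (real N * \<phi>)) + b * (cis (real N * \<phi>) * cis (- (real N * \<phi>)))"
      by (simp only: algebra_simps)
    moreover have "\<dots> = a * cis (2 * real N * \<phi>) + b"
      by (simp only: cis_mult) (simp add: algebra_simps)
    ultimately show ?thesis by (simp add: add_eq_0_iff2)
  qed
  have "a \<noteq> 0" using e[OF 1] ab by auto
  moreover have "a * cis (2 * real N * \<theta>) = a * (cis (2 * real N * \<theta>) * cis (2 * real N * \<alpha>))"
    using e[OF 1] e[OF 2] by (simp add: cis_mult algebra_simps)
  ultimately have "cis (2 * real N * \<alpha>) = 1" by simp
  then have "cos (2 * real N * \<alpha>) = 1" by (simp add: complex_eq_iff)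
  then obtain n :: int where "2 * real N * \<alpha> = of_int n * 2 * pi" using cos_one_2pi_int by blast
  then have "\<alpha> = (of_int n / of_nat N) * pi" using N by (simp add: field_simps)
  then show ?thesis by (intro bexI[of _ "of_int n / of_nat N"]) auto
qed

section \<open>Cones at a Lipschitz boundary point and the exclusion of cusps\<close>

lemma polar_unit_dir:
  fixes x :: "real^2"
  assumes "x \<noteq> 0"
  obtains \<phi> c where "\<phi> \<in> {\<theta>..<\<theta> + 2*pi}" "c > 0" "x = c *\<^sub>R unit_dir \<phi>"
proof -
  \<comment> \<open>Rotation by \<open>- \<theta>\<close> moves the cut of \<open>Arg2pi\<close> to
    the direction \<open>\<theta>\<close>.\<close>
  define z where "z = plane_coord x * cis (- \<theta>)"
  have nz: "norm z = norm x" by (simp add: z_def norm_mult)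
  have z: "z = of_real (norm x) * cis (Arg2pi z)"
    using Arg2pi_eq[of z] nz by (simp add: cis_conv_exp)
  have "plane_coord x = z * cis \<theta>" by (simp add: z_def cis_mult mult.assoc)
  also have "\<dots> = of_real (norm x) * (cis (Arg2pi z) * cis \<theta>)"
    by (subst z) (simp add: mult.assoc)
  also have "\<dots> = of_real (norm x) * cis (\<theta> + Arg2pi z)"
    by (simp add: cis_mult add.commute)
  finally have "x = norm x *\<^sub>R unit_dir (\<theta> + Arg2pi z)"
    by (simp add: plane_coord_def unit_dir_def complex_eq_iff vec_eq_iff forall_2)
  then show thesis
    by (rule that[rotated 2]) (use Arg2pi_ge_0[of z] Arg2pi_lt_2pi[of z] assms in auto)
qed

text \<open>At a cusp \<open>corner_point\<close> describes every ray except the one in direction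
  \<open>\<theta>\<close>. Of two non-parallel vectors, at least one points elsewhere.\<close>

lemma avoid_direction:
  fixes x y :: "real^2"
  assumes "x \<noteq> 0" "y \<noteq> 0" "\<And>c. x \<noteq> c *\<^sub>R y"
  obtains \<phi> c where "\<phi> \<in> {\<theta><..<\<theta> + 2*pi}" "c > 0" "x = c *\<^sub>R unit_dir \<phi> \<or> y = c *\<^sub>R unit_dir \<phi>"
proof -
  obtain \<phi> c where \<phi>: "\<phi> \<in> {\<theta>..<\<theta> + 2*pi}" "c > 0" "x = c *\<^sub>R unit_dir \<phi>"
    using polar_unit_dir[OF assms(1)] by blast
  obtain \<psi> d where \<psi>: "\<psi> \<in> {\<theta>..<\<theta> + 2*pi}" "d > 0" "y = d *\<^sub>R unit_dir \<psi>"
    using polar_unit_dir[OF assms(2)] by blast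
  have "x = (c / d) *\<^sub>R y" if "\<phi> = \<psi>" using \<phi> \<psi> that by simp
  then have "\<phi> \<noteq> \<theta> \<or> \<psi> \<noteq> \<theta>" using assms(3) by blast
  then show thesis
  proof
    assume "\<phi> \<noteq> \<theta>"
    with \<phi> show ?thesis by (intro that[of \<phi> c]) auto
  next
    assume "\<psi> \<noteq> \<theta>"
    with \<psi> show ?thesis by (intro that[of \<psi> d]) auto
  qed
qed

text \<open>Directions steeper than \<open>L\<close> relative to \<open>e2\<close> enter the
  epigraph, and their negatives leave it. Two non-parallel ones are supplied because a single one
  might be the tangent direction of the cusp. The scaling by \<open>c\<close> fits the polar form of
  a vector.\<close>

lemma lipschitz_boundary_cones:
  assumes lip: "lipschitz_boundary \<Omega>" and \<Omega>: "open \<Omega>" and p: "p \<in> frontier \<Omega>"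
  obtains x y :: "real^2" where "x \<noteq> 0" "y \<noteq> 0" "\<And>c. x \<noteq> c *\<^sub>R y"
    "\<And>c u. c > 0 \<Longrightarrow> x = c *\<^sub>R u \<or> y = c *\<^sub>R u \<Longrightarrow> \<forall>\<^sub>F s in at_right 0. p + s *\<^sub>R u \<in> \<Omega>"
    "\<And>c u. c > 0 \<Longrightarrow> - x = c *\<^sub>R u \<or> - y = c *\<^sub>R u \<Longrightarrow> \<forall>\<^sub>F s in at_right 0. p + s *\<^sub>R u \<notin> \<Omega>"
proof -
  obtain e1 e2 r L and g :: "real \<Rightarrow> real" where e: "norm e1 = 1" "norm e2 = 1" "e1 \<bullet> e2 = 0"
    and r: "r > 0" and g: "L-lipschitz_on UNIV g"
    and eq: "\<Omega> \<inter> ball p r = {x \<in> ball p r. g (x \<bullet> e1) < x \<bullet> e2}"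
    using bspec[OF lip[unfolded lipschitz_boundary_def] p] by (elim exE conjE) (rule that)
  have ee: "e1 \<bullet> e1 = 1" "e2 \<bullet> e2 = 1" using e by (simp_all add: norm_eq_1)
  have L: "L \<ge> 0" using g by (rule lipschitz_on_nonneg)
  have mem: "x \<in> \<Omega> \<longleftrightarrow> g (x \<bullet> e1) < x \<bullet> e2" if "x \<in> ball p r" for x
    using eq that by blast
  \<comment> \<open>The boundary point lies on the graph: below or on it because
    \<open>\<Omega>\<close> is open, and not strictly below because a neighbourhood of it would then
    miss \<open>\<Omega>\<close>.\<close>
  have gp: "g (p \<bullet> e1) = p \<bullet> e2"
  proof (rule antisym)
    have "p \<notin> \<Omega>" using p \<Omega> by (simp add: frontier_def interior_open)
    then show "p \<bullet> e2 \<le> g (p \<bullet> e1)" using mem[of p] r by simp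
    show "g (p \<bullet> e1) \<le> p \<bullet> e2"
    proof (rule ccontr)
      assume *: "\<not> g (p \<bullet> e1) \<le> p \<bullet> e2"
      have "continuous_on UNIV g" using g by (rule lipschitz_on_continuous_on)
      then have "continuous_on UNIV (\<lambda>x. g (x \<bullet> e1))"
        by (rule continuous_on_compose2) (auto intro!: continuous_intros)
      then have "open {x. x \<bullet> e2 < g (x \<bullet> e1)}"
        by (intro open_Collect_less continuous_intros)
      then have "open ({x. x \<bullet> e2 < g (x \<bullet> e1)} \<inter> ball p r)" by (intro open_Int) auto
      moreover have "p \<in> {x. x \<bullet> e2 < g (x \<bullet> e1)} \<inter> ball p r \<inter> closure \<Omega>"
        using p r * by (simp add: frontier_def)
      ultimately have "{x. x \<bullet> e2 < g (x \<bullet> e1)} \<inter> ball p r \<inter> \<Omega> \<noteq> {}"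
        using open_Int_closure_eq_empty[of _ \<Omega>] by blast
      then obtain y where "y \<in> \<Omega>" "y \<in> ball p r" "y \<bullet> e2 < g (y \<bullet> e1)" by blast
      then show False using mem[of y] by simp
    qed
  qed
  have near: "\<forall>\<^sub>F s in at_right 0. p + s *\<^sub>R u \<in> ball p r" for u
  proof -
    have "((\<lambda>s. p + s *\<^sub>R u) \<longlongrightarrow> p + 0 *\<^sub>R u) (at_right 0)" by (intro tendsto_intros)
    then have "\<forall>\<^sub>F s in at_right 0. dist (p + s *\<^sub>R u) p < r" using r tendstoD by fastforce
    then show ?thesis by (simp add: dist_commute)
  qed
  have gL: "\<bar>g ((p + s *\<^sub>R u) \<bullet> e1) - p \<bullet> e2\<bar> \<le> L * (s * \<bar>u \<bullet> e1\<bar>)" if "s > 0" for s u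
    using lipschitz_onD[OF g, of "(p + s *\<^sub>R u) \<bullet> e1" "p \<bullet> e1"] gp that
    by (simp add: dist_real_def inner_add_left abs_mult)
  have inside: "\<forall>\<^sub>F s in at_right 0. p + s *\<^sub>R u \<in> \<Omega>" if u: "L * \<bar>u \<bullet> e1\<bar> < u \<bullet> e2" for u
    using near[of u] eventually_at_right_less[of 0]
  proof eventually_elim
    case (elim s)
    have "s * (L * \<bar>u \<bullet> e1\<bar>) < s * (u \<bullet> e2)" by (rule mult_strict_left_mono[OF u elim(2)])
    moreover have "\<bar>g ((p + s *\<^sub>R u) \<bullet> e1) - p \<bullet> e2\<bar> \<le> s * (L * \<bar>u \<bullet> e1\<bar>)"
      using gL[OF elim(2), of u] by (simp only: mult.left_commute[of L s])
    moreover have "(p + s *\<^sub>R u) \<bullet> e2 = p \<bullet> e2 + s * (u \<bullet> e2)" by (simp add: inner_add_left)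
    ultimately have "g ((p + s *\<^sub>R u) \<bullet> e1) < (p + s *\<^sub>R u) \<bullet> e2" by linarith
    then show ?case using mem elim by simp
  qed
  have outside: "\<forall>\<^sub>F s in at_right 0. p + s *\<^sub>R u \<notin> \<Omega>" if u: "L * \<bar>u \<bullet> e1\<bar> < - (u \<bullet> e2)" for u
    using near[of u] eventually_at_right_less[of 0]
  proof eventually_elim
    case (elim s)
    have "s * (L * \<bar>u \<bullet> e1\<bar>) < s * (- (u \<bullet> e2))" by (rule mult_strict_left_mono[OF u elim(2)])
    moreover have "\<bar>g ((p + s *\<^sub>R u) \<bullet> e1) - p \<bullet> e2\<bar> \<le> s * (L * \<bar>u \<bullet> e1\<bar>)"
      using gL[OF elim(2), of u] by (simp only: mult.left_commute[of L s])
    moreover have "(p + s *\<^sub>R u) \<bullet> e2 = p \<bullet> e2 - s * (- (u \<bullet> e2))" by (simp add: inner_add_left)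
    ultimately have "\<not> g ((p + s *\<^sub>R u) \<bullet> e1) < (p + s *\<^sub>R u) \<bullet> e2" by linarith
    then show ?case using mem elim by simp
  qed
  \<comment> \<open>A tilt of \<open>e2\<close> by \<open>1 / (L + 1)\<close> is small enough to
    stay in the cone, as \<open>L / (L + 1) < 1\<close>, and nonzero, so that \<open>y\<close> is
    not parallel to \<open>e2\<close>.\<close>
  define y where "y = e2 + (1 / (L + 1)) *\<^sub>R e1"
  have y1: "y \<bullet> e1 = 1 / (L + 1)" "y \<bullet> e2 = 1"
    using e ee by (simp_all add: y_def inner_add_left inner_commute[of e2 e1])
  have x1: "e2 \<bullet> e1 = 0" using e by (simp add: inner_commute)
  have cone: "L * \<bar>u \<bullet> e1\<bar> < u \<bullet> e2" if "c > 0" "e2 = c *\<^sub>R u \<or> y = c *\<^sub>R u" for c u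
  proof -
    have "L * \<bar>y \<bullet> e1\<bar> < y \<bullet> e2" unfolding y1 using L by (simp add: field_simps)
    then have "L * \<bar>v \<bullet> e1\<bar> < v \<bullet> e2" if "v = e2 \<or> v = y" for v
      using that ee x1 by auto
    then have "L * \<bar>(c *\<^sub>R u) \<bullet> e1\<bar> < (c *\<^sub>R u) \<bullet> e2" using that(2) by metis
    then have "c * (L * \<bar>u \<bullet> e1\<bar>) < c * (u \<bullet> e2)" using that(1) by (simp add: abs_mult mult_ac)
    then show ?thesis using that(1) by simp
  qed
  show thesis
  proof (rule that[of e2 y])
    show "e2 \<noteq> 0" "y \<noteq> 0" using e y1 by auto
    show "e2 \<noteq> c *\<^sub>R y" for c
    proof
      assume *: "e2 = c *\<^sub>R y"
      have "c * (1 / (L + 1)) = 0" using x1 arg_cong[OF *, of "\<lambda>v. v \<bullet> e1"] y1 by simp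
      moreover have "c = 1" using ee arg_cong[OF *, of "\<lambda>v. v \<bullet> e2"] y1 by simp
      ultimately show False using L by simp
    qed
    show "\<forall>\<^sub>F s in at_right 0. p + s *\<^sub>R u \<in> \<Omega>" if "c > 0" "e2 = c *\<^sub>R u \<or> y = c *\<^sub>R u" for c u
      by (rule inside, rule cone) (use that in auto)
    show "\<forall>\<^sub>F s in at_right 0. p + s *\<^sub>R u \<notin> \<Omega>" if "c > 0" "- e2 = c *\<^sub>R u \<or> - y = c *\<^sub>R u" for c u
    proof (rule outside)
      have "e2 = c *\<^sub>R (- u) \<or> y = c *\<^sub>R (- u)" using that(2) by (metis minus_minus scaleR_minus_right)
      from cone[OF that(1) this] show "L * \<bar>u \<bullet> e1\<bar> < - (u \<bullet> e2)" by simp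
    qed
  qed
qed

text \<open>For \<open>\<alpha> = 0\<close> every direction but \<open>\<theta>\<close> would leave
  \<open>\<Omega>\<close>, against the interior cone; for \<open>\<alpha> = 2 * pi\<close> every
  direction but \<open>\<theta>\<close> would enter it, against the exterior cone.\<close>

lemma corner_angle_not_cusp:
  assumes lip: "lipschitz_boundary \<Omega>" and \<Omega>: "open \<Omega>" and corner: "corner_point \<Omega> p \<alpha>"
  shows "0 < \<alpha>" "\<alpha> < 2 * pi"
proof -
  have p: "p \<in> frontier \<Omega>" and \<alpha>: "0 \<le> \<alpha>" "\<alpha> \<le> 2 * pi"
    using corner by (auto simp: corner_point_def)
  obtain \<theta> where ins: "\<And>\<phi>. \<phi> \<in> {\<theta><..<\<theta> + \<alpha>} \<Longrightarrow> \<forall>\<^sub>F r in at_right 0. p + r *\<^sub>R unit_dir \<phi> \<in> \<Omega>"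
    and outs: "\<And>\<phi>. \<phi> \<in> {\<theta> + \<alpha><..<\<theta> + 2 * pi} \<Longrightarrow> \<forall>\<^sub>F r in at_right 0. p + r *\<^sub>R unit_dir \<phi> \<notin> \<Omega>"
    using corner unfolding corner_point_def by blast
  obtain x y :: "real^2" where xy: "x \<noteq> 0" "y \<noteq> 0" "\<And>c. x \<noteq> c *\<^sub>R y"
    and cin: "\<And>c u. c > 0 \<Longrightarrow> x = c *\<^sub>R u \<or> y = c *\<^sub>R u \<Longrightarrow> \<forall>\<^sub>F s in at_right 0. p + s *\<^sub>R u \<in> \<Omega>"
    and cout: "\<And>c u. c > 0 \<Longrightarrow> - x = c *\<^sub>R u \<or> - y = c *\<^sub>R u \<Longrightarrow> \<forall>\<^sub>F s in at_right 0. p + s *\<^sub>R u \<notin> \<Omega>"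
    using lipschitz_boundary_cones[OF lip \<Omega> p] by blast
  have clash: False if "\<forall>\<^sub>F s in at_right (0::real). p + s *\<^sub>R u \<in> \<Omega>" "\<forall>\<^sub>F s in at_right (0::real). p + s *\<^sub>R u \<notin> \<Omega>" for u
  proof -
    have "\<forall>\<^sub>F s in at_right (0::real). False" using that by eventually_elim blast
    then show False by simp
  qed
  show "0 < \<alpha>"
  proof (rule ccontr)
    assume "\<not> 0 < \<alpha>"
    then have "\<alpha> = 0" using \<alpha> by simp
    obtain \<phi> c where \<phi>: "\<phi> \<in> {\<theta><..<\<theta> + 2*pi}" "c > 0" "x = c *\<^sub>R unit_dir \<phi> \<or> y = c *\<^sub>R unit_dir \<phi>"
      by (rule avoid_direction[OF xy])
    have "\<phi> \<in> {\<theta> + \<alpha><..<\<theta> + 2 * pi}" using \<phi>(1) \<open>\<alpha> = 0\<close> by simp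
    from clash[OF cin[OF \<phi>(2,3)] outs[OF this]] show False .
  qed
  show "\<alpha> < 2 * pi"
  proof (rule ccontr)
    assume "\<not> \<alpha> < 2 * pi"
    then have "\<alpha> = 2 * pi" using \<alpha> by simp
    have "- x \<noteq> c *\<^sub>R (- y)" for c using xy(3)[of c] by simp
    moreover have "- x \<noteq> 0" "- y \<noteq> 0" using xy(1,2) by simp_all
    ultimately obtain \<phi> c where \<phi>: "\<phi> \<in> {\<theta><..<\<theta> + 2*pi}" "c > 0" "- x = c *\<^sub>R unit_dir \<phi> \<or> - y = c *\<^sub>R unit_dir \<phi>"
      using avoid_direction[of "- x" "- y" \<theta>] by blast
    have "\<phi> \<in> {\<theta><..<\<theta> + \<alpha>}" using \<phi>(1) \<open>\<alpha> = 2 * pi\<close> by simp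
    from clash[OF ins[OF this] cout[OF \<phi>(2,3)]] show False .
  qed
qed

theorem proposition2p12:
  fixes \<Omega> U :: "(real^2) set" and v v' :: "real^2 \<Rightarrow> complex"
    and k \<alpha> :: real and P :: "real^2"
  assumes "open \<Omega>" and "connected \<Omega>" and "\<Omega> \<noteq> {}" and "bounded \<Omega>"
    and "lipschitz_boundary \<Omega>"
    and "connected (- closure \<Omega>)"
    and "k > 0" and "dirichlet_eigenfunction k \<Omega> v"
    and "open U" and "closure \<Omega> \<subseteq> U" and "helmholtz_on k U v'"
    and "\<And>x. x \<in> \<Omega> \<Longrightarrow> v' x = v x"
    and "P \<in> frontier \<Omega>" and "corner_point \<Omega> P \<alpha>"
  shows "\<alpha> \<in> {0<..<2 * pi} \<inter> {r * pi | r. r \<in> \<rat>}"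
proof -
  have v: "helmholtz_on k \<Omega> v" "continuous_on (closure \<Omega>) v"
    "\<And>x. x \<in> frontier \<Omega> \<Longrightarrow> v x = 0" and nz: "\<exists>x\<in>\<Omega>. v x \<noteq> 0"
    using assms(8) unfolding dirichlet_eigenfunction_def by auto
  have "continuous_on U v'"
    using assms(11) unfolding helmholtz_on_def C2_on_def C1_on_def
    by (auto intro!: continuous_at_imp_continuous_on differentiable_imp_continuous_within)
  then have v'c: "continuous_on (closure \<Omega>) v'" using assms(10) by (rule continuous_on_subset)
  \<comment> \<open>The extension agrees with \<open>v\<close> only inside \<open>\<Omega>\<close>
    by assumption; continuity carries the agreement, and with it the boundary condition, to the
    frontier.\<close>
  have "v' x - v x = 0" if "x \<in> closure \<Omega>" for x
    by (rule continuous_constant_on_closure[of \<Omega> "\<lambda>x. v' x - v x"])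
      (use assms(12) that v'c v(2) in \<open>auto intro!: continuous_intros\<close>)
  then have v'0: "v' x = 0" if "x \<in> frontier \<Omega>" for x
    using v(3)[OF that] that by (simp add: frontier_def)
  have Pc: "P \<in> closure \<Omega>" using assms(13) by (simp add: frontier_def)
  then obtain \<rho> where \<rho>: "\<rho> > 0" "ball P \<rho> \<subseteq> U"
    using assms(9,10) by (meson open_contains_ball subsetD)
  obtain R where R: "0 < R" "R < \<rho>" "k\<^sup>2 * R\<^sup>2 \<le> 1/2" using obtain_disc_radius[OF \<rho>(1)] .
  \<comment> \<open>The disc around \<open>P\<close> meets \<open>\<Omega>\<close>, so if
    \<open>v'\<close> vanished on it, \<open>v\<close> would vanish near some point of
    \<open>\<Omega>\<close>. Unique continuation is applied to \<open>v\<close> on the connected set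
    \<open>\<Omega>\<close>, since \<open>U\<close> may be disconnected.\<close>
  have "\<exists>x0\<in>ball P R. v' x0 \<noteq> 0"
  proof (rule ccontr)
    assume "\<not> (\<exists>x0\<in>ball P R. v' x0 \<noteq> 0)"
    then have z: "v' x = 0" if "x \<in> ball P R" for x using that by blast
    obtain x1 where x1: "x1 \<in> \<Omega>" "dist x1 P < R"
      using Pc R(1) closure_approachable by blast
    then have "x1 \<in> \<Omega> \<inter> ball P R" by (simp add: dist_commute)
    then obtain \<delta> where \<delta>: "\<delta> > 0" "ball x1 \<delta> \<subseteq> \<Omega> \<inter> ball P R"
      using assms(1) by (meson open_Int open_ball open_contains_ball)
    have "v x = 0" if "x \<in> ball x1 \<delta>" for x
    proof -
      have "x \<in> \<Omega>" "x \<in> ball P R" using \<delta>(2) that by auto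
      then show ?thesis using z[of x] assms(12)[of x] by simp
    qed
    then have "v x = 0" if "x \<in> \<Omega>" for x
      using helmholtz_unique_continuation[OF v(1) assms(1,2) x1(1) \<delta>(1) _ that] by blast
    then show False using nz by blast
  qed
  then obtain x0 where x0: "x0 \<in> ball P R" "v' x0 \<noteq> 0" by blast
  obtain N a b K where N: "N > 0" "a \<noteq> 0 \<or> b \<noteq> 0"
    and lead: "\<And>x. x \<in> ball P (R/2) \<Longrightarrow> norm (v' x - (a * plane_coord (x - P) ^ N + b * cnj (plane_coord (x - P)) ^ N))
      \<le> K * norm (x - P) ^ (N + 1)"
    by (rule helmholtz_leading_term[OF assms(11) \<rho>(2) R v'0[OF assms(13)] x0]) blast
  obtain \<theta> \<gamma>1 \<gamma>2 \<epsilon> where \<gamma>: "regular_arc_from P \<theta> \<gamma>1" "regular_arc_from P (\<theta> + \<alpha>) \<gamma>2" "\<epsilon> > 0"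
    "frontier \<Omega> \<inter> ball P \<epsilon> = (path_image \<gamma>1 \<union> path_image \<gamma>2) \<inter> ball P \<epsilon>"
    using assms(14) unfolding corner_point_def by blast
  have z1: "v' (\<gamma>1 t) = 0" if "t \<in> {0..1}" "\<gamma>1 t \<in> ball P \<epsilon>" for t
    using \<gamma>(4) that by (intro v'0) (auto simp: path_image_def)
  have z2: "v' (\<gamma>2 t) = 0" if "t \<in> {0..1}" "\<gamma>2 t \<in> ball P \<epsilon>" for t
    using \<gamma>(4) that by (intro v'0) (auto simp: path_image_def)
  have R2: "R / 2 > 0" using R by simp
  have "\<exists>r\<in>\<rat>. \<alpha> = r * pi"
    by (rule angle_rational_if_leading_terms_vanish[OF N
        leading_term_vanishes_along_arc[OF \<gamma>(1) z1 \<gamma>(3) lead R2]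
        leading_term_vanishes_along_arc[OF \<gamma>(2) z2 \<gamma>(3) lead R2]])
  then show ?thesis using corner_angle_not_cusp[OF assms(5,1,14)] by auto
qed

end
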